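(* Let $k\ge1$, let $\mathsf{F}$ be a field, and let $\Lambda$ be a row-finite $k$-graph without sources such that $|\Lambda^0|<\infty$. If $\mathrm{KP}_{\mathsf F}(\Lambda)$ is a crossed product (as a $\mathbb{Z}^k$-graded algebra), then $\Lambda$ satisfies Condition (HNE), i.e. no loop in $\Lambda$ has an entrance.
   Context: $\mathbb{N}=\{0,1,2,\dots\}$; $\mathbb{Z}^k$ has the coordinatewise order. A $k$-graph is a countable small category $\Lambda$ with a functor $d:\Lambda\to\mathbb{N}^k$ (degree) such that whenever $d(\lambda)=\mathbf{n}+\mathbf{m}$ with $\mathbf{n},\mathbf{m}\in\mathbb{N}^k$ there are unique $\alpha,\beta\in\Lambda$ with $d(\alpha)=\mathbf{n}$, $d(\beta)=\mathbf{m}$, $\lambda=\alpha\beta$. The codomain and domain of a morphism (path) $\lambda$ are $r(\lambda)$ and $s(\lambda)$; $\lambda\mu$ is defined when $s(\lambda)=r(\mu)$. $\Lambda^{\mathbf{n}}=d^{-1}(\mathbf{n})$; elements of $\Lambda^0$ are identified with objects (vertices). $v\Lambda=\{\lambda: r(\lambda)=v\}$, $v\Lambda^{\mathbf{n}}=v\Lambda\cap\Lambda^{\mathbf{n}}$. $\Lambda$ is row-finite without sources if $0<|v\Lambda^{\mathbf{n}}|<\infty$ for all $v,\mathbf{n}$. For $0\le\mathbf{n}\le\mathbf{m}\le d(\lambda)$, $\lambda(\mathbf{n},\mathbf{m})$ is the unique path of degree $\mathbf{m}-\mathbf{n}$ with $\lambda=\alpha\lambda(\mathbf{n},\mathbf{m})\beta$,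 $d(\alpha)=\mathbf{n}$, $d(\beta)=d(\lambda)-\mathbf{m}$. A loop is a path $\mu$ with $r(\mu)=s(\mu)$. An entrance to a loop $\mu$ is a path $\lambda\in s(\mu)\Lambda$ with $d(\lambda)\le d(\mu)$ and $\mu(0,d(\lambda))\ne\lambda$. $\mathrm{KP}_{\mathsf F}(\Lambda)$ is the universal associative $\mathsf{F}$-algebra generated by $p_v$ ($v\in\Lambda^0$), $s_\lambda,s_{\lambda^*}$ ($\lambda\in\Lambda\setminus\Lambda^0$) with relations: (KP1) $p_up_v=\delta_{u,v}p_u$; (KP2) $s_\lambda s_\mu=s_{\lambda\mu}$, $s_{\mu^*}s_{\lambda^*}=s_{(\lambda\mu)^*}$ when $s(\lambda)=r(\mu)$, $p_{r(\lambda)}s_\lambda=s_\lambda=s_\lambda p_{s(\lambda)}$, $p_{s(\lambda)}s_{\lambda^*}=s_{\lambda^*}=s_{\lambda^*}p_{r(\lambda)}$; (KP3) $s_{\lambda^*}s_\mu=\delta_{\lambda,\mu}p_{s(\lambda)}$ if $d(\lambda)=d(\mu)$; (KP4) $p_v=\sum_{\lambda\in v\Lambda^{\mathbf{n}}}s_\lambda s_{\lambda^*}$ for all $v$, $\mathbf{n}\ne0$. With $s_v=s_{v^*}=p_v$, it is $\mathbb{Z}^k$-graded with $\mathrm{KP}_{\mathsf F}(\Lambda)_{\mathbf{n}}=\mathrm{span}_{\mathsf F}\{s_\lambda s_{\mu^*}: d(\lambda)-d(\mu)=\mathbf{n}\}$; it is unital since $|\Lambda^0|<\infty$. A $\Gamma$-graded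 unital algebra $A=\bigoplus_{\gamma\in\Gamma}A_\gamma$ is a crossed product if every $A_\gamma$ contains an invertible element of $A$. *)

theory Defs
  imports
    "HOL-Analysis.Finite_Cartesian_Product"
    "HOL-Library.Poly_Mapping"
    "HOL-Algebra.Algebraic_Closure_Type"
begin

section \<open>Higher-rank graphs\<close>

text \<open>
  The rank is the cardinality of the index type \<open>'k\<close>, which is automatically at least 1;
  \<^typ>\<open>nat^'k\<close> and \<^typ>\<open>int^'k\<close> carry the coordinatewise addition and order.
  A path \<open>\<kappa>\<close> goes from its source (domain) to its range (codomain), and
  \<open>cmp \<Lambda> \<kappa> \<mu>\<close> is meaningful when \<open>src \<Lambda> \<kappa> = rng \<Lambda> \<mu>\<close>.
\<close>

record ('v, 'm, 'k::finite) kgraph =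
  Obj   :: "'v set"
  Mor   :: "'m set"
  rng   :: "'m \<Rightarrow> 'v"
  src   :: "'m \<Rightarrow> 'v"
  ident :: "'v \<Rightarrow> 'm"
  cmp   :: "'m \<Rightarrow> 'm \<Rightarrow> 'm"
  deg   :: "'m \<Rightarrow> nat^'k"

locale small_category =
  fixes \<Lambda> :: "('v, 'm, 'k::finite) kgraph"
  assumes rng_closed: "\<kappa> \<in> Mor \<Lambda> \<Longrightarrow> rng \<Lambda> \<kappa> \<in> Obj \<Lambda>"
    and src_closed: "\<kappa> \<in> Mor \<Lambda> \<Longrightarrow> src \<Lambda> \<kappa> \<in> Obj \<Lambda>"
    and ident_closed: "v \<in> Obj \<Lambda> \<Longrightarrow> ident \<Lambda> v \<in> Mor \<Lambda>"
    and rng_ident: "v \<in> Obj \<Lambda> \<Longrightarrow> rng \<Lambda> (ident \<Lambda> v) = v"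
    and src_ident: "v \<in> Obj \<Lambda> \<Longrightarrow> src \<Lambda> (ident \<Lambda> v) = v"
    and comp_closed: "\<lbrakk>\<kappa> \<in> Mor \<Lambda>; \<mu> \<in> Mor \<Lambda>; src \<Lambda> \<kappa> = rng \<Lambda> \<mu>\<rbrakk> \<Longrightarrow> cmp \<Lambda> \<kappa> \<mu> \<in> Mor \<Lambda>"
    and rng_comp: "\<lbrakk>\<kappa> \<in> Mor \<Lambda>; \<mu> \<in> Mor \<Lambda>; src \<Lambda> \<kappa> = rng \<Lambda> \<mu>\<rbrakk> \<Longrightarrow> rng \<Lambda> (cmp \<Lambda> \<kappa> \<mu>) = rng \<Lambda> \<kappa>"
    and src_comp: "\<lbrakk>\<kappa> \<in> Mor \<Lambda>; \<mu> \<in> Mor \<Lambda>; src \<Lambda> \<kappa> = rng \<Lambda> \<mu>\<rbrakk> \<Longrightarrow> src \<Lambda> (cmp \<Lambda> \<kappa> \<mu>) = src \<Lambda> \<mu>"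
    and ident_comp: "\<kappa> \<in> Mor \<Lambda> \<Longrightarrow> cmp \<Lambda> (ident \<Lambda> (rng \<Lambda> \<kappa>)) \<kappa> = \<kappa>"
    and comp_ident: "\<kappa> \<in> Mor \<Lambda> \<Longrightarrow> cmp \<Lambda> \<kappa> (ident \<Lambda> (src \<Lambda> \<kappa>)) = \<kappa>"
    and comp_assoc:
      "\<lbrakk>\<kappa> \<in> Mor \<Lambda>; \<mu> \<in> Mor \<Lambda>; \<nu> \<in> Mor \<Lambda>; src \<Lambda> \<kappa> = rng \<Lambda> \<mu>; src \<Lambda> \<mu> = rng \<Lambda> \<nu>\<rbrakk>
        \<Longrightarrow> cmp \<Lambda> (cmp \<Lambda> \<kappa> \<mu>) \<nu> = cmp \<Lambda> \<kappa> (cmp \<Lambda> \<mu> \<nu>)"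

locale k_graph = small_category \<Lambda>
  for \<Lambda> :: "('v, 'm, 'k::finite) kgraph" +
  assumes countable_Mor: "countable (Mor \<Lambda>)"
    and deg_ident: "v \<in> Obj \<Lambda> \<Longrightarrow> deg \<Lambda> (ident \<Lambda> v) = 0"
    and deg_comp:
      "\<lbrakk>\<kappa> \<in> Mor \<Lambda>; \<mu> \<in> Mor \<Lambda>; src \<Lambda> \<kappa> = rng \<Lambda> \<mu>\<rbrakk>
        \<Longrightarrow> deg \<Lambda> (cmp \<Lambda> \<kappa> \<mu>) = deg \<Lambda> \<kappa> + deg \<Lambda> \<mu>"
    and factorization:
      "\<lbrakk>\<kappa> \<in> Mor \<Lambda>; deg \<Lambda> \<kappa> = n + m\<rbrakk>
        \<Longrightarrow> \<exists>!p. case p of (\<alpha>, \<beta>) \<Rightarrow>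
              \<alpha> \<in> Mor \<Lambda> \<and> \<beta> \<in> Mor \<Lambda> \<and> src \<Lambda> \<alpha> = rng \<Lambda> \<beta> \<and>
              deg \<Lambda> \<alpha> = n \<and> deg \<Lambda> \<beta> = m \<and> \<kappa> = cmp \<Lambda> \<alpha> \<beta>"

definition paths :: "('v, 'm, 'k::finite) kgraph \<Rightarrow> nat^'k \<Rightarrow> 'm set" where
  "paths \<Lambda> n = {\<kappa> \<in> Mor \<Lambda>. deg \<Lambda> \<kappa> = n}"

definition paths_at :: "('v, 'm, 'k::finite) kgraph \<Rightarrow> 'v \<Rightarrow> nat^'k \<Rightarrow> 'm set" where
  "paths_at \<Lambda> v n = {\<kappa> \<in> paths \<Lambda> n. rng \<Lambda> \<kappa> = v}"

definition row_finite_no_sources :: "('v, 'm, 'k::finite) kgraph \<Rightarrow> bool" where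
  "row_finite_no_sources \<Lambda> \<longleftrightarrow>
     (\<forall>v \<in> Obj \<Lambda>. \<forall>n. finite (paths_at \<Lambda> v n) \<and> 0 < card (paths_at \<Lambda> v n))"

text \<open>\<open>segment \<Lambda> \<kappa> n m\<close> is the factor of \<open>\<kappa>\<close> between the degrees \<open>n\<close> and \<open>m\<close>, for \<open>n \<le> m \<le> deg \<Lambda> \<kappa>\<close>.\<close>

definition segment :: "('v, 'm, 'k::finite) kgraph \<Rightarrow> 'm \<Rightarrow> nat^'k \<Rightarrow> nat^'k \<Rightarrow> 'm" where
  "segment \<Lambda> \<kappa> n m =
     (THE \<beta>. \<beta> \<in> Mor \<Lambda> \<and> deg \<Lambda> \<beta> = m - n \<and>
        (\<exists>\<alpha> \<in> Mor \<Lambda>. \<exists>\<gamma> \<in> Mor \<Lambda>.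
           src \<Lambda> \<alpha> = rng \<Lambda> \<beta> \<and> src \<Lambda> \<beta> = rng \<Lambda> \<gamma> \<and>
           deg \<Lambda> \<alpha> = n \<and> deg \<Lambda> \<gamma> = deg \<Lambda> \<kappa> - m \<and>
           \<kappa> = cmp \<Lambda> \<alpha> (cmp \<Lambda> \<beta> \<gamma>)))"

definition loop :: "('v, 'm, 'k::finite) kgraph \<Rightarrow> 'm \<Rightarrow> bool" where
  "loop \<Lambda> \<mu> \<longleftrightarrow> \<mu> \<in> Mor \<Lambda> \<and> rng \<Lambda> \<mu> = src \<Lambda> \<mu>"

definition entrance :: "('v, 'm, 'k::finite) kgraph \<Rightarrow> 'm \<Rightarrow> 'm \<Rightarrow> bool" where
  "entrance \<Lambda> \<mu> \<kappa> \<longleftrightarrow>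
     \<kappa> \<in> Mor \<Lambda> \<and> rng \<Lambda> \<kappa> = src \<Lambda> \<mu> \<and> deg \<Lambda> \<kappa> \<le> deg \<Lambda> \<mu> \<and>
     segment \<Lambda> \<mu> 0 (deg \<Lambda> \<kappa>) \<noteq> \<kappa>"

definition HNE :: "('v, 'm, 'k::finite) kgraph \<Rightarrow> bool" where
  "HNE \<Lambda> \<longleftrightarrow> (\<forall>\<mu>. loop \<Lambda> \<mu> \<longrightarrow> \<not> (\<exists>\<kappa>. entrance \<Lambda> \<mu> \<kappa>))"


section \<open>Algebras presented by generators and relations\<close>

text \<open>
  The type \<open>'g free_word \<Rightarrow>\<^sub>0 'f\<close> is the monoid algebra of the free monoid on \<open>'g\<close>,
  that is, the free unital associative algebra on \<open>'g\<close>.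
\<close>

datatype 'g free_word = Word (letters: "'g list")

instantiation free_word :: (type) monoid_add
begin

definition zero_free_word :: "'a free_word" where
  "0 = Word []"

definition plus_free_word :: "'a free_word \<Rightarrow> 'a free_word \<Rightarrow> 'a free_word" where
  "u + w = Word (letters u @ letters w)"

instance
  by standard (simp_all add: zero_free_word_def plus_free_word_def)

end

definition free_gen :: "'g \<Rightarrow> ('g free_word \<Rightarrow>\<^sub>0 'f::field)" where
  "free_gen x = Poly_Mapping.single (Word [x]) 1"

definition free_algebra :: "'g set \<Rightarrow> ('g free_word \<Rightarrow>\<^sub>0 'f::field) ring" where
  "free_algebra gs =
     ring_of_type_algebra
       \<lparr>carrier := {a. \<forall>w \<in> Poly_Mapping.keys a. set (letters w) \<subseteq> gs}\<rparr>"

text \<open>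
  The universal associative, not necessarily unital, algebra on the generators \<open>gs\<close> subject to
  the relations \<open>a = 0\<close> for \<open>a \<in> Rel\<close>. The free non-unital algebra on \<open>gs\<close> is the subalgebra of
  \<open>free_algebra gs\<close> of the elements without constant term; \<open>Rel\<close> is meant to consist of such
  elements, and then the ideal it generates in \<open>free_algebra gs\<close> is also the ideal it generates
  in the non-unital algebra. The element \<open>e\<close> is meant to represent an identity element, if there
  is one, and only determines the \<open>one\<close> field.
\<close>

definition presented_class ::
  "'g set \<Rightarrow> ('g free_word \<Rightarrow>\<^sub>0 'f::field) set \<Rightarrow>
    ('g free_word \<Rightarrow>\<^sub>0 'f) \<Rightarrow> ('g free_word \<Rightarrow>\<^sub>0 'f) set" where
  "presented_class gs Rel a = Idl\<^bsub>free_algebra gs\<^esub> Rel +>\<^bsub>free_algebra gs\<^esub> a"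

definition presented_algebra ::
  "'g set \<Rightarrow> ('g free_word \<Rightarrow>\<^sub>0 'f::field) set \<Rightarrow> ('g free_word \<Rightarrow>\<^sub>0 'f) \<Rightarrow>
    ('f, ('g free_word \<Rightarrow>\<^sub>0 'f) set) module" where
  "presented_algebra gs Rel e =
     \<lparr>carrier = presented_class gs Rel `
        {a \<in> carrier (free_algebra gs). Poly_Mapping.lookup a 0 = 0},
      monoid.mult = rcoset_mult (free_algebra gs) (Idl\<^bsub>free_algebra gs\<^esub> Rel),
      one = presented_class gs Rel e,
      ring.zero = presented_class gs Rel 0,
      add = set_add (free_algebra gs),
      module.smult = (\<lambda>c A. \<Union>a\<in>A. presented_class gs Rel (Poly_Mapping.single 0 c * a))\<rparr>"

definition lin_span :: "('f::field, 'a) module \<Rightarrow> 'a set \<Rightarrow> 'a set" where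
  "lin_span A S = {finsum A (\<lambda>x. c x \<odot>\<^bsub>A\<^esub> x) T | c T. finite T \<and> T \<subseteq> S}"

text \<open>
  For a unital algebra \<open>A\<close> graded by the group \<open>'g\<close> with homogeneous components \<open>H \<gamma>\<close>.
\<close>

definition crossed_product :: "('a, 'b) ring_scheme \<Rightarrow> ('g::group_add \<Rightarrow> 'a set) \<Rightarrow> bool" where
  "crossed_product A H \<longleftrightarrow> (\<forall>\<gamma>. \<exists>x \<in> H \<gamma>. x \<in> Units A)"


section \<open>Kumjian--Pask algebras\<close>

datatype ('v, 'm) kp_gen = Gen_p 'v | Gen_s 'm | Gen_s_star 'm

definition kp_gens :: "('v, 'm, 'k::finite) kgraph \<Rightarrow> ('v, 'm) kp_gen set" where
  "kp_gens \<Lambda> = Gen_p ` Obj \<Lambda> \<union> Gen_s ` (Mor \<Lambda> - paths \<Lambda> 0)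
    \<union> Gen_s_star ` (Mor \<Lambda> - paths \<Lambda> 0)"

abbreviation fp :: "'v \<Rightarrow> (('v, 'm) kp_gen free_word \<Rightarrow>\<^sub>0 'f::field)" where
  "fp v \<equiv> free_gen (Gen_p v)"

abbreviation fs :: "'m \<Rightarrow> (('v, 'm) kp_gen free_word \<Rightarrow>\<^sub>0 'f::field)" where
  "fs \<kappa> \<equiv> free_gen (Gen_s \<kappa>)"

abbreviation fs_star :: "'m \<Rightarrow> (('v, 'm) kp_gen free_word \<Rightarrow>\<^sub>0 'f::field)" where
  "fs_star \<kappa> \<equiv> free_gen (Gen_s_star \<kappa>)"

inductive_set kp_relations ::
  "('v, 'm, 'k::finite) kgraph \<Rightarrow> (('v, 'm) kp_gen free_word \<Rightarrow>\<^sub>0 'f::field) set"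
  for \<Lambda> :: "('v, 'm, 'k::finite) kgraph"
where
  KP1: "\<lbrakk>u \<in> Obj \<Lambda>; v \<in> Obj \<Lambda>\<rbrakk>
    \<Longrightarrow> fp u * fp v - (if u = v then fp u else 0) \<in> kp_relations \<Lambda>"
| KP2_comp: "\<lbrakk>\<kappa> \<in> Mor \<Lambda> - paths \<Lambda> 0; \<mu> \<in> Mor \<Lambda> - paths \<Lambda> 0; src \<Lambda> \<kappa> = rng \<Lambda> \<mu>\<rbrakk>
    \<Longrightarrow> fs \<kappa> * fs \<mu> - fs (cmp \<Lambda> \<kappa> \<mu>) \<in> kp_relations \<Lambda>"
| KP2_comp_star: "\<lbrakk>\<kappa> \<in> Mor \<Lambda> - paths \<Lambda> 0; \<mu> \<in> Mor \<Lambda> - paths \<Lambda> 0; src \<Lambda> \<kappa> = rng \<Lambda> \<mu>\<rbrakk>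
    \<Longrightarrow> fs_star \<mu> * fs_star \<kappa> - fs_star (cmp \<Lambda> \<kappa> \<mu>) \<in> kp_relations \<Lambda>"
| KP2_rng: "\<kappa> \<in> Mor \<Lambda> - paths \<Lambda> 0 \<Longrightarrow> fp (rng \<Lambda> \<kappa>) * fs \<kappa> - fs \<kappa> \<in> kp_relations \<Lambda>"
| KP2_src: "\<kappa> \<in> Mor \<Lambda> - paths \<Lambda> 0 \<Longrightarrow> fs \<kappa> * fp (src \<Lambda> \<kappa>) - fs \<kappa> \<in> kp_relations \<Lambda>"
| KP2_src_star: "\<kappa> \<in> Mor \<Lambda> - paths \<Lambda> 0
    \<Longrightarrow> fp (src \<Lambda> \<kappa>) * fs_star \<kappa> - fs_star \<kappa> \<in> kp_relations \<Lambda>"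
| KP2_rng_star: "\<kappa> \<in> Mor \<Lambda> - paths \<Lambda> 0
    \<Longrightarrow> fs_star \<kappa> * fp (rng \<Lambda> \<kappa>) - fs_star \<kappa> \<in> kp_relations \<Lambda>"
| KP3: "\<lbrakk>\<kappa> \<in> Mor \<Lambda> - paths \<Lambda> 0; \<mu> \<in> Mor \<Lambda> - paths \<Lambda> 0; deg \<Lambda> \<kappa> = deg \<Lambda> \<mu>\<rbrakk>
    \<Longrightarrow> fs_star \<kappa> * fs \<mu> - (if \<kappa> = \<mu> then fp (src \<Lambda> \<kappa>) else 0) \<in> kp_relations \<Lambda>"
| KP4: "\<lbrakk>v \<in> Obj \<Lambda>; n \<noteq> 0\<rbrakk>
    \<Longrightarrow> fp v - (\<Sum>\<kappa> \<in> paths_at \<Lambda> v n. fs \<kappa> * fs_star \<kappa>) \<in> kp_relations \<Lambda>"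

text \<open>
  \<open>KP TYPE('f) \<Lambda>\<close> is the Kumjian--Pask algebra over the field \<open>'f\<close>, for
  \<open>\<Lambda>\<close> with finitely many vertices: its identity is then the sum of the vertex idempotents.
\<close>

definition KP :: "'f::field itself \<Rightarrow> ('v, 'm, 'k::finite) kgraph \<Rightarrow>
    ('f, (('v, 'm) kp_gen free_word \<Rightarrow>\<^sub>0 'f) set) module" where
  "KP _ \<Lambda> = presented_algebra (kp_gens \<Lambda>) (kp_relations \<Lambda>) (\<Sum>v \<in> Obj \<Lambda>. fp v)"

text \<open>The paths of degree 0 are the identity morphisms, and \<open>s\<close> and \<open>s*\<close> of such a path is the vertex idempotent.\<close>

definition kp_s :: "'f::field itself \<Rightarrow> ('v, 'm, 'k::finite) kgraph \<Rightarrow> 'm \<Rightarrow>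
    (('v, 'm) kp_gen free_word \<Rightarrow>\<^sub>0 'f) set" where
  "kp_s _ \<Lambda> \<kappa> = presented_class (kp_gens \<Lambda>) (kp_relations \<Lambda>)
     (if \<kappa> \<in> paths \<Lambda> 0 then fp (rng \<Lambda> \<kappa>) else fs \<kappa>)"

definition kp_s_star :: "'f::field itself \<Rightarrow> ('v, 'm, 'k::finite) kgraph \<Rightarrow> 'm \<Rightarrow>
    (('v, 'm) kp_gen free_word \<Rightarrow>\<^sub>0 'f) set" where
  "kp_s_star _ \<Lambda> \<kappa> = presented_class (kp_gens \<Lambda>) (kp_relations \<Lambda>)
     (if \<kappa> \<in> paths \<Lambda> 0 then fp (rng \<Lambda> \<kappa>) else fs_star \<kappa>)"

definition int_vec :: "nat^'k \<Rightarrow> int^'k" where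
  "int_vec n = (\<chi> i. int (vec_nth n i))"

definition KP_component :: "'f::field itself \<Rightarrow> ('v, 'm, 'k::finite) kgraph \<Rightarrow> int^'k \<Rightarrow>
    (('v, 'm) kp_gen free_word \<Rightarrow>\<^sub>0 'f) set set" where
  "KP_component F \<Lambda> n = lin_span (KP F \<Lambda>)
     {kp_s F \<Lambda> \<kappa> \<otimes>\<^bsub>KP F \<Lambda>\<^esub> kp_s_star F \<Lambda> \<mu> | \<kappa> \<mu>.
        \<kappa> \<in> Mor \<Lambda> \<and> \<mu> \<in> Mor \<Lambda> \<and> int_vec (deg \<Lambda> \<kappa>) - int_vec (deg \<Lambda> \<mu>) = n}"

end

theory Submission
  imports Defs
begin

text \<open>
  Suppose a loop \<open>\<mu>\<close> of degree \<open>n\<close> has an entrance. Following \<open>\<mu>\<close> or leaving it shows that the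
  number of paths of degree \<open>m + j n\<close> is unbounded in \<open>j\<close>, so
  \<open>card (paths \<Lambda> m) < card (paths \<Lambda> (m + n))\<close> for some arbitrarily large \<open>m\<close>.
  The Kumjian--Pask algebra acts on functions on paths, taken modulo functions that vanish in
  large degrees. If \<open>m\<close> is large, an element of degree \<open>n\<close> acts as a matrix with one row for each
  path of degree \<open>m + n\<close> and one column for each path of degree \<open>m\<close>. A matrix with more rows
  than columns is not right invertible.
\<close>

text \<open>The inverse of the unit need not be known to be homogeneous: it is lifted to an
  arbitrary polynomial \<open>b\<close>, and only the homogeneous factor becomes a matrix. Rows and
  columns have to be counted, so the representation lives on finite paths; the price is that (KP4)
  fails on short ones. The size of \<open>m\<close> is forced by the unit: it is a finite
  combination of monomials, and \<open>m\<close> must dominate the degrees of all their starred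
  paths, so that each monomial rewrites an initial segment lying inside the row index. Hence the
  strict growth of the number of paths is needed beyond every prescribed bound. The matrix is block
  diagonal with respect to sources, but the counting argument controls only all paths together; a
  kernel vector of the whole matrix is therefore found first and then cut down to one block. Its
  entries do not depend on the tail appended to the indices, so one tail of large degree carries the
  whole block past the threshold hidden in \<open>negligible\<close>.\<close>

lemma vec_add_diff_inverse:
  fixes n m :: "nat^'k::finite"
  shows "n \<le> m \<Longrightarrow> n + (m - n) = m"
  by (auto simp: vec_eq_iff less_eq_vec_def)

lemma vec_le_add:
  fixes n m :: "nat^'k::finite"
  shows "n \<le> n + m" "n \<le> m + n"
  by (auto simp: less_eq_vec_def)

lemma vec_add_le_cancel:
  fixes n m :: "nat^'k::finite"
  shows "n + p \<le> m + p \<longleftrightarrow> n \<le> m"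
  by (auto simp: less_eq_vec_def)

lemma int_vec_diff_eq_iff: "int_vec p - int_vec q = int_vec n \<longleftrightarrow> p = q + n"
proof -
  have "int a - int b = int c \<longleftrightarrow> a = b + c" for a b c by linarith
  then show ?thesis by (simp add: int_vec_def vec_eq_iff)
qed

text \<open>Gaussian elimination, one column at a time, with arbitrary finite index sets. It is used
  with rows and columns indexed by paths.\<close>

lemma exists_left_kernel:
  fixes M :: "'a \<Rightarrow> 'b \<Rightarrow> 'f::field"
  assumes "finite Q" "finite P" "card Q < card P"
  shows "\<exists>z. (\<exists>p\<in>P. z p \<noteq> 0) \<and> (\<forall>q\<in>Q. (\<Sum>p\<in>P. z p * M p q) = 0)"
  using assms
proof (induction Q arbitrary: P M rule: finite_induct)
  case empty
  then have "P \<noteq> {}" by auto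
  then show ?case by (intro exI[of _ "\<lambda>_. 1"]) auto
next
  case (insert q0 Q)
  show ?case
  proof (cases "\<forall>p\<in>P. M p q0 = 0")
    case True
    obtain z where "\<exists>p\<in>P. z p \<noteq> 0" "\<forall>q\<in>Q. (\<Sum>p\<in>P. z p * M p q) = 0"
      using insert.IH[of P M] insert.prems insert.hyps by auto
    with True show ?thesis by (intro exI[of _ z]) auto
  next
    case False
    then obtain p0 where p0: "p0 \<in> P" "M p0 q0 \<noteq> 0" by auto
    define P' where "P' = P - {p0}"
    have P': "finite P'" "card Q < card P'" "p0 \<notin> P'" "P = Set.insert p0 P'"
      using insert.prems insert.hyps p0 by (auto simp: P'_def)
    \<comment> \<open>The pivot row \<open>p0\<close> is used to clear column \<open>q0\<close> and
      is then dropped, so both counts go down by one.\<close>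
    obtain z where z: "\<exists>p\<in>P'. z p \<noteq> 0"
      "\<forall>q\<in>Q. (\<Sum>p\<in>P'. z p * (M p q - M p q0 / M p0 q0 * M p0 q)) = 0"
      using insert.IH[of P' "\<lambda>p q. M p q - M p q0 / M p0 q0 * M p0 q"] P' by blast
    \<comment> \<open>The only coefficient of row \<open>p0\<close> that kills column
      \<open>q0\<close>. With it, the equations in the other columns are those of the reduced
      matrix.\<close>
    define c where "c = - (\<Sum>p\<in>P'. z p * M p q0) / M p0 q0"
    define z' where "z' = z(p0 := c)"
    have eq: "(\<Sum>p\<in>P. z' p * M p q) = c * M p0 q + (\<Sum>p\<in>P'. z p * M p q)" for q
    proof -
      have "(\<Sum>p\<in>P'. z' p * M p q) = (\<Sum>p\<in>P'. z p * M p q)"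
        using P'(3) by (intro sum.cong) (auto simp: z'_def)
      then show ?thesis using P' by (simp add: z'_def)
    qed
    have "(\<Sum>p\<in>P. z' p * M p q) = 0" if "q \<in> Set.insert q0 Q" for q
    proof (cases "q = q0")
      case True
      then show ?thesis using p0 by (simp add: eq c_def)
    next
      case False
      with that z(2) have "(\<Sum>p\<in>P'. z p * (M p q - M p q0 / M p0 q0 * M p0 q)) = 0" by auto
      also have "(\<Sum>p\<in>P'. z p * (M p q - M p q0 / M p0 q0 * M p0 q))
          = (\<Sum>p\<in>P'. z p * M p q) - (\<Sum>p\<in>P'. z p * M p q0) / M p0 q0 * M p0 q"
        by (simp add: right_diff_distrib sum_subtractf sum_distrib_right sum_divide_distrib mult.assoc)
      finally show ?thesis by (simp add: eq c_def)
    qed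
    moreover have "\<exists>p\<in>P. z' p \<noteq> 0" using z(1) P'(3,4) by (auto simp: z'_def)
    ultimately show ?thesis by blast
  qed
qed


section \<open>Paths\<close>

context k_graph
begin

text \<open>Uniqueness of factorizations. Comparing the degrees of the left factors is enough,
  because additivity and cancellation then match those of the right factors.\<close>

lemma comp_unique:
  assumes "\<kappa> \<in> Mor \<Lambda>" "\<rho> \<in> Mor \<Lambda>" "src \<Lambda> \<kappa> = rng \<Lambda> \<rho>"
    and "\<kappa>' \<in> Mor \<Lambda>" "\<rho>' \<in> Mor \<Lambda>" "src \<Lambda> \<kappa>' = rng \<Lambda> \<rho>'"
    and "cmp \<Lambda> \<kappa> \<rho> = cmp \<Lambda> \<kappa>' \<rho>'" "deg \<Lambda> \<kappa> = deg \<Lambda> \<kappa>'"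
  shows "\<kappa> = \<kappa>' \<and> \<rho> = \<rho>'"
proof -
  have d: "deg \<Lambda> \<rho> = deg \<Lambda> \<rho>'"
    using assms deg_comp add_left_cancel by metis
  have "cmp \<Lambda> \<kappa> \<rho> \<in> Mor \<Lambda>" "deg \<Lambda> (cmp \<Lambda> \<kappa> \<rho>) = deg \<Lambda> \<kappa> + deg \<Lambda> \<rho>"
    using assms(1-3) comp_closed deg_comp by blast+
  from factorization[OF this] obtain p where p: "\<And>q. (case q of (\<alpha>, \<beta>) \<Rightarrow>
      \<alpha> \<in> Mor \<Lambda> \<and> \<beta> \<in> Mor \<Lambda> \<and> src \<Lambda> \<alpha> = rng \<Lambda> \<beta> \<and> deg \<Lambda> \<alpha> = deg \<Lambda> \<kappa> \<and>
      deg \<Lambda> \<beta> = deg \<Lambda> \<rho> \<and> cmp \<Lambda> \<kappa> \<rho> = cmp \<Lambda> \<alpha> \<beta>) \<Longrightarrow> q = p"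
    by blast
  show ?thesis using p[of "(\<kappa>, \<rho>)"] p[of "(\<kappa>', \<rho>')"] assms d by simp
qed

lemma factor:
  assumes "\<kappa> \<in> Mor \<Lambda>" "n \<le> deg \<Lambda> \<kappa>"
  obtains \<alpha> \<beta> where "\<alpha> \<in> Mor \<Lambda>" "\<beta> \<in> Mor \<Lambda>" "src \<Lambda> \<alpha> = rng \<Lambda> \<beta>" "deg \<Lambda> \<alpha> = n"
    "deg \<Lambda> \<beta> = deg \<Lambda> \<kappa> - n" "\<kappa> = cmp \<Lambda> \<alpha> \<beta>"
proof -
  have "deg \<Lambda> \<kappa> = n + (deg \<Lambda> \<kappa> - n)" using assms vec_add_diff_inverse by metis
  from factorization[OF assms(1) this] show thesis using that by auto
qed

text \<open>Composing \<open>\<kappa>\<close> with the identity on its left or on its right gives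
  two factorizations of \<open>\<kappa>\<close> into paths of degree 0, which must agree.\<close>

lemma deg_zero_ident:
  assumes "\<kappa> \<in> Mor \<Lambda>" "deg \<Lambda> \<kappa> = 0"
  shows "\<kappa> = ident \<Lambda> (rng \<Lambda> \<kappa>)" and "src \<Lambda> \<kappa> = rng \<Lambda> \<kappa>"
proof -
  have "cmp \<Lambda> (ident \<Lambda> (rng \<Lambda> \<kappa>)) \<kappa> = cmp \<Lambda> \<kappa> (ident \<Lambda> (src \<Lambda> \<kappa>))"
    using assms by (simp add: ident_comp comp_ident)
  then have "ident \<Lambda> (rng \<Lambda> \<kappa>) = \<kappa>"
    using assms comp_unique[of "ident \<Lambda> (rng \<Lambda> \<kappa>)" \<kappa> \<kappa> "ident \<Lambda> (src \<Lambda> \<kappa>)"]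
    by (simp add: ident_closed rng_ident src_ident deg_ident rng_closed src_closed)
  then show "\<kappa> = ident \<Lambda> (rng \<Lambda> \<kappa>)" by simp
  then show "src \<Lambda> \<kappa> = rng \<Lambda> \<kappa>" using assms rng_closed src_ident by metis
qed

text \<open>In any decomposition competing in the definite description, the leading factor has
  degree 0 and is an identity, so unique factorization applies. This is how the condition on an
  entrance gets compared with actual composites.\<close>

lemma segment_0_comp:
  assumes "\<beta> \<in> Mor \<Lambda>" "\<gamma> \<in> Mor \<Lambda>" "src \<Lambda> \<beta> = rng \<Lambda> \<gamma>"
  shows "segment \<Lambda> (cmp \<Lambda> \<beta> \<gamma>) 0 (deg \<Lambda> \<beta>) = \<beta>"
  unfolding segment_def
proof (rule the_equality, goal_cases)
  case 1
  have "deg \<Lambda> \<gamma> = deg \<Lambda> (cmp \<Lambda> \<beta> \<gamma>) - deg \<Lambda> \<beta>"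
    using assms by (simp add: deg_comp)
  moreover have "cmp \<Lambda> (ident \<Lambda> (rng \<Lambda> \<beta>)) (cmp \<Lambda> \<beta> \<gamma>) = cmp \<Lambda> \<beta> \<gamma>"
    using ident_comp[OF comp_closed[OF assms]] rng_comp[OF assms] by simp
  ultimately show ?case
    using assms by (intro conjI bexI[of _ "ident \<Lambda> (rng \<Lambda> \<beta>)"] bexI[of _ \<gamma>])
      (simp_all add: ident_closed rng_closed src_ident deg_ident)
next
  case (2 \<beta>')
  then obtain \<alpha> \<gamma>' where *: "\<alpha> \<in> Mor \<Lambda>" "\<gamma>' \<in> Mor \<Lambda>" "\<beta>' \<in> Mor \<Lambda>" "deg \<Lambda> \<beta>' = deg \<Lambda> \<beta>"
    "src \<Lambda> \<alpha> = rng \<Lambda> \<beta>'" "src \<Lambda> \<beta>' = rng \<Lambda> \<gamma>'" "deg \<Lambda> \<alpha> = 0"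
    "cmp \<Lambda> \<beta> \<gamma> = cmp \<Lambda> \<alpha> (cmp \<Lambda> \<beta>' \<gamma>')"
    by auto
  have "\<alpha> = ident \<Lambda> (rng \<Lambda> (cmp \<Lambda> \<beta>' \<gamma>'))"
    using deg_zero_ident[of \<alpha>] * rng_comp by metis
  then have "cmp \<Lambda> \<beta> \<gamma> = cmp \<Lambda> \<beta>' \<gamma>'"
    using * ident_comp comp_closed by metis
  then show ?case using comp_unique[of \<beta>' \<gamma>' \<beta> \<gamma>] * assms by auto
qed

lemma finite_Obj:
  assumes "finite (paths \<Lambda> 0)"
  shows "finite (Obj \<Lambda>)"
proof (rule finite_imageD)
  show "finite (ident \<Lambda> ` Obj \<Lambda>)"
    using assms by (rule finite_subset[rotated]) (auto simp: paths_def ident_closed deg_ident)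
  show "inj_on (ident \<Lambda>) (Obj \<Lambda>)" by (metis inj_onI rng_ident)
qed

lemma finite_paths:
  assumes "finite (paths \<Lambda> 0)" "row_finite_no_sources \<Lambda>"
  shows "finite (paths \<Lambda> n)"
proof (rule finite_subset)
  show "paths \<Lambda> n \<subseteq> (\<Union>v\<in>Obj \<Lambda>. paths_at \<Lambda> v n)"
    by (auto simp: paths_def paths_at_def rng_closed)
  show "finite (\<Union>v\<in>Obj \<Lambda>. paths_at \<Lambda> v n)"
    using finite_Obj assms by (auto simp: row_finite_no_sources_def)
qed

lemma path_exists:
  assumes "row_finite_no_sources \<Lambda>" "v \<in> Obj \<Lambda>"
  obtains \<tau> where "\<tau> \<in> Mor \<Lambda>" "rng \<Lambda> \<tau> = v" "deg \<Lambda> \<tau> = n"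
proof -
  have "paths_at \<Lambda> v n \<noteq> {}"
    using assms by (metis card.empty less_irrefl row_finite_no_sources_def)
  then show thesis using that by (auto simp: paths_at_def paths_def)
qed

text \<open>Each round prefixes \<open>\<mu>\<close> to all paths already counted, injectively, and
  adds at least one path that does not begin with \<open>\<mu>\<close>. The iterated addition stands
  for \<open>m\<close> plus \<open>j\<close> times the degree of the loop.\<close>

lemma loop_entrance_growth:
  assumes rf: "row_finite_no_sources \<Lambda>" and \<mu>: "loop \<Lambda> \<mu>" and ent: "entrance \<Lambda> \<mu> \<kappa>"
  shows "j < card (paths_at \<Lambda> (src \<Lambda> \<mu>) (((\<lambda>p. p + deg \<Lambda> \<mu>) ^^ j) m))"
proof -
  define v where "v = src \<Lambda> \<mu>"
  have \<mu>': "\<mu> \<in> Mor \<Lambda>" "rng \<Lambda> \<mu> = v" "src \<Lambda> \<mu> = v" "v \<in> Obj \<Lambda>"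
    using \<mu> src_closed by (auto simp: loop_def v_def)
  have \<kappa>: "\<kappa> \<in> Mor \<Lambda>" "rng \<Lambda> \<kappa> = v" "deg \<Lambda> \<kappa> \<le> deg \<Lambda> \<mu>" "segment \<Lambda> \<mu> 0 (deg \<Lambda> \<kappa>) \<noteq> \<kappa>"
    using ent by (auto simp: entrance_def v_def)
  \<comment> \<open>Pads the entrance to the full degree of the loop, so that the result and
    \<open>\<mu>\<close> are distinct paths of equal degree.\<close>
  obtain \<tau> where \<tau>: "\<tau> \<in> Mor \<Lambda>" "rng \<Lambda> \<tau> = src \<Lambda> \<kappa>" "deg \<Lambda> \<tau> = deg \<Lambda> \<mu> - deg \<Lambda> \<kappa>"
    using path_exists[OF rf] src_closed \<kappa>(1) by metis
  define \<nu> where "\<nu> = cmp \<Lambda> \<kappa> \<tau>"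
  have \<nu>: "\<nu> \<in> Mor \<Lambda>" "rng \<Lambda> \<nu> = v" "deg \<Lambda> \<nu> = deg \<Lambda> \<mu>"
    using \<kappa> \<tau> by (auto simp: \<nu>_def comp_closed rng_comp deg_comp vec_add_diff_inverse)
  have ne: "\<nu> \<noteq> \<mu>"
    using segment_0_comp[of \<kappa> \<tau>] \<kappa> \<tau> by (auto simp: \<nu>_def)
  define f where "f j = ((\<lambda>p. p + deg \<Lambda> \<mu>) ^^ j) m" for j
  have fin: "finite (paths_at \<Lambda> v n)" for n
    using rf \<mu>'(4) by (auto simp: row_finite_no_sources_def)
  have "j < card (paths_at \<Lambda> v (f j))" for j
  proof (induction j)
    case 0
    then show ?case using rf \<mu>'(4) by (auto simp: row_finite_no_sources_def)
  next
    case (Suc j)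
    \<comment> \<open>The source of \<open>\<nu>\<close> may differ from \<open>v\<close>, so the
      induction hypothesis says nothing about its continuations; one continuation suffices.\<close>
    obtain \<sigma> where \<sigma>: "\<sigma> \<in> Mor \<Lambda>" "rng \<Lambda> \<sigma> = src \<Lambda> \<nu>" "deg \<Lambda> \<sigma> = f j"
      using path_exists[OF rf] src_closed \<nu>(1) by metis
    have sub: "Set.insert (cmp \<Lambda> \<nu> \<sigma>) (cmp \<Lambda> \<mu> ` paths_at \<Lambda> v (f j)) \<subseteq> paths_at \<Lambda> v (f (Suc j))"
      using \<sigma> \<nu> \<mu>' by (auto simp: paths_at_def paths_def comp_closed rng_comp deg_comp f_def add.commute)
    have notin: "cmp \<Lambda> \<nu> \<sigma> \<notin> cmp \<Lambda> \<mu> ` paths_at \<Lambda> v (f j)"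
    proof
      assume "cmp \<Lambda> \<nu> \<sigma> \<in> cmp \<Lambda> \<mu> ` paths_at \<Lambda> v (f j)"
      then obtain \<rho> where "\<rho> \<in> Mor \<Lambda>" "rng \<Lambda> \<rho> = v" "cmp \<Lambda> \<nu> \<sigma> = cmp \<Lambda> \<mu> \<rho>"
        by (auto simp: paths_at_def paths_def)
      then show False using comp_unique[of \<nu> \<sigma> \<mu> \<rho>] \<sigma> \<nu> \<mu>' ne by simp
    qed
    have inj: "inj_on (cmp \<Lambda> \<mu>) (paths_at \<Lambda> v (f j))"
    proof (rule inj_onI)
      fix \<rho> \<rho>'
      assume "\<rho> \<in> paths_at \<Lambda> v (f j)" "\<rho>' \<in> paths_at \<Lambda> v (f j)" "cmp \<Lambda> \<mu> \<rho> = cmp \<Lambda> \<mu> \<rho>'"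
      then show "\<rho> = \<rho>'"
        using comp_unique[of \<mu> \<rho> \<mu> \<rho>'] \<mu>' by (simp add: paths_at_def paths_def)
    qed
    have "Suc j < card (Set.insert (cmp \<Lambda> \<nu> \<sigma>) (cmp \<Lambda> \<mu> ` paths_at \<Lambda> v (f j)))"
      using notin inj Suc fin by (simp add: card_image)
    also have "\<dots> \<le> card (paths_at \<Lambda> v (f (Suc j)))"
      using card_mono[OF fin sub] .
    finally show ?case .
  qed
  then show ?thesis by (simp add: f_def v_def)
qed

lemma loop_entrance_card_less:
  assumes rf: "row_finite_no_sources \<Lambda>" and fin: "finite (paths \<Lambda> 0)"
    and \<mu>: "loop \<Lambda> \<mu>" and ent: "entrance \<Lambda> \<mu> \<kappa>"
  obtains m where "m0 \<le> m" "card (paths \<Lambda> m) < card (paths \<Lambda> (m + deg \<Lambda> \<mu>))"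
proof -
  define f where "f j = ((\<lambda>p. p + deg \<Lambda> \<mu>) ^^ j) m0" for j
  have ge: "m0 \<le> f j" for j
    by (induction j) (auto simp: f_def intro: order.trans[OF _ vec_le_add(1)])
  have grow: "j < card (paths \<Lambda> (f j))" for j
  proof -
    have "card (paths_at \<Lambda> (src \<Lambda> \<mu>) (f j)) \<le> card (paths \<Lambda> (f j))"
      by (rule card_mono[OF finite_paths[OF fin rf]]) (auto simp: paths_at_def)
    then show ?thesis using loop_entrance_growth[OF rf \<mu> ent, of j m0] by (simp add: f_def)
  qed
  \<comment> \<open>Otherwise the counts never increase and stay below the first of them, which
    \<open>grow\<close> refutes at the index equal to that first count.\<close>
  have "\<exists>j. card (paths \<Lambda> (f j)) < card (paths \<Lambda> (f (Suc j)))"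
  proof (rule ccontr)
    assume "\<not> ?thesis"
    then have "decseq (\<lambda>j. card (paths \<Lambda> (f j)))"
      by (intro decseq_SucI) (auto simp: not_less)
    then have "card (paths \<Lambda> (f (card (paths \<Lambda> (f 0))))) \<le> card (paths \<Lambda> (f 0))"
      by (auto dest: decseqD)
    with grow[of "card (paths \<Lambda> (f 0))"] show False by linarith
  qed
  then obtain j where "card (paths \<Lambda> (f j)) < card (paths \<Lambda> (f (Suc j)))" ..
  then show thesis using that[of "f j"] ge by (simp add: f_def)
qed

end


section \<open>A representation of the free algebra\<close>

text \<open>
  A generator acts on functions on paths by the formula for the boundary path representation.
  On finite paths the relation (KP4) only holds at paths of sufficiently large degree, which is
  why functions are considered up to \<open>negligible\<close> ones.
\<close>

definition extends :: "('v, 'm, 'k::finite) kgraph \<Rightarrow> 'm \<Rightarrow> 'm \<Rightarrow> 'm \<Rightarrow> bool" where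
  "extends \<Lambda> \<kappa> \<rho> \<tau> \<longleftrightarrow> \<kappa> \<in> Mor \<Lambda> \<and> \<rho> \<in> Mor \<Lambda> \<and> src \<Lambda> \<kappa> = rng \<Lambda> \<rho> \<and> cmp \<Lambda> \<kappa> \<rho> = \<tau>"

primrec gen_act ::
  "('v, 'm, 'k::finite) kgraph \<Rightarrow> ('v, 'm) kp_gen \<Rightarrow> ('m \<Rightarrow> 'f::field) \<Rightarrow> 'm \<Rightarrow> 'f" where
  "gen_act \<Lambda> (Gen_p v) f \<tau> = (if rng \<Lambda> \<tau> = v then f \<tau> else 0)"
| "gen_act \<Lambda> (Gen_s \<kappa>) f \<tau> =
     (if \<exists>\<rho>. extends \<Lambda> \<kappa> \<rho> \<tau> then f (THE \<rho>. extends \<Lambda> \<kappa> \<rho> \<tau>) else 0)"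
| "gen_act \<Lambda> (Gen_s_star \<kappa>) f \<tau> =
     (if \<kappa> \<in> Mor \<Lambda> \<and> src \<Lambda> \<kappa> = rng \<Lambda> \<tau> then f (cmp \<Lambda> \<kappa> \<tau>) else 0)"

definition word_act ::
  "('v, 'm, 'k::finite) kgraph \<Rightarrow> ('v, 'm) kp_gen free_word \<Rightarrow> ('m \<Rightarrow> 'f::field) \<Rightarrow> 'm \<Rightarrow> 'f" where
  "word_act \<Lambda> w = foldr (gen_act \<Lambda>) (letters w)"

definition act :: "('v, 'm, 'k::finite) kgraph \<Rightarrow> (('v, 'm) kp_gen free_word \<Rightarrow>\<^sub>0 'f::field) \<Rightarrow>
    ('m \<Rightarrow> 'f) \<Rightarrow> 'm \<Rightarrow> 'f" where
  "act \<Lambda> a f \<tau> = (\<Sum>w\<in>Poly_Mapping.keys a. Poly_Mapping.lookup a w * word_act \<Lambda> w f \<tau>)"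

definition negligible :: "('v, 'm, 'k::finite) kgraph \<Rightarrow> ('m \<Rightarrow> 'f::field) \<Rightarrow> bool" where
  "negligible \<Lambda> f \<longleftrightarrow> (\<exists>N. \<forall>\<tau>\<in>Mor \<Lambda>. N \<le> deg \<Lambda> \<tau> \<longrightarrow> f \<tau> = 0)"

section \<open>Linearity and multiplicativity of the action\<close>

lemma gen_act_sum:
  "gen_act \<Lambda> x (\<lambda>\<sigma>. \<Sum>i\<in>A. c i * g i \<sigma>) = (\<lambda>\<tau>. \<Sum>i\<in>A. c i * gen_act \<Lambda> x (g i) \<tau>)"
  by (cases x) (auto simp: fun_eq_iff)

lemma word_act_sum:
  "word_act \<Lambda> w (\<lambda>\<sigma>. \<Sum>i\<in>A. c i * g i \<sigma>) = (\<lambda>\<tau>. \<Sum>i\<in>A. c i * word_act \<Lambda> w (g i) \<tau>)"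
proof (cases w)
  case (Word xs)
  then show ?thesis
    by (induction xs arbitrary: w) (auto simp: word_act_def gen_act_sum)
qed

lemma word_act_add: "word_act \<Lambda> (u + w) f = word_act \<Lambda> u (word_act \<Lambda> w f)"
  by (simp add: word_act_def plus_free_word_def)

lemma word_act_zero [simp]: "word_act \<Lambda> 0 f = f"
  by (simp add: word_act_def zero_free_word_def)

lemma act_superset:
  assumes "finite W" "Poly_Mapping.keys a \<subseteq> W"
  shows "act \<Lambda> a f \<tau> = (\<Sum>w\<in>W. Poly_Mapping.lookup a w * word_act \<Lambda> w f \<tau>)"
  unfolding act_def using assms by (intro sum.mono_neutral_left) (auto simp: in_keys_iff)

lemma act_zero [simp]: "act \<Lambda> 0 f \<tau> = 0"
  by (simp add: act_def)

lemma act_single [simp]: "act \<Lambda> (Poly_Mapping.single w c) f \<tau> = c * word_act \<Lambda> w f \<tau>"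
  by (subst act_superset[of "{w}"]) auto

lemma act_add: "act \<Lambda> (a + b) f \<tau> = act \<Lambda> a f \<tau> + act \<Lambda> b f \<tau>"
proof -
  let ?W = "Poly_Mapping.keys a \<union> Poly_Mapping.keys b"
  show ?thesis
    using keys_add[of a b]
    by (simp add: act_superset[of ?W] lookup_add distrib_right sum.distrib)
qed

lemma act_uminus: "act \<Lambda> (- a) f \<tau> = - act \<Lambda> a f \<tau>"
  using act_add[of \<Lambda> "- a" a f \<tau>] by (simp add: eq_neg_iff_add_eq_0)

lemma act_diff: "act \<Lambda> (a - b) f \<tau> = act \<Lambda> a f \<tau> - act \<Lambda> b f \<tau>"
  using act_add[of \<Lambda> a "- b" f \<tau>] by (simp add: act_uminus)

lemma act_sum: "act \<Lambda> (\<Sum>i\<in>A. g i) f \<tau> = (\<Sum>i\<in>A. act \<Lambda> (g i) f \<tau>)"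
  by (induction A rule: infinite_finite_induct) (auto simp: act_add)

lemma poly_mapping_sum_single:
  "a = (\<Sum>w\<in>Poly_Mapping.keys a. Poly_Mapping.single w (Poly_Mapping.lookup a w))"
  by (rule poly_mapping_eqI) (auto simp: lookup_sum lookup_single when_def in_keys_iff)

text \<open>Concatenating words composes their actions, and word actions are linear; the general
  case follows by expanding both factors into monomials.\<close>

lemma act_mult: "act \<Lambda> (a * b) f = act \<Lambda> a (act \<Lambda> b f)"
proof
  fix \<tau>
  let ?A = "Poly_Mapping.keys a" and ?B = "Poly_Mapping.keys b"
  let ?c = "Poly_Mapping.lookup a" and ?d = "Poly_Mapping.lookup b"
  have "a * b = (\<Sum>u\<in>?A. \<Sum>w\<in>?B. Poly_Mapping.single (u + w) (?c u * ?d w))"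
    by (subst poly_mapping_sum_single[of a], subst poly_mapping_sum_single[of b])
      (simp add: sum_product mult_single)
  then have "act \<Lambda> (a * b) f \<tau> = (\<Sum>u\<in>?A. ?c u * (\<Sum>w\<in>?B. ?d w * word_act \<Lambda> u (word_act \<Lambda> w f) \<tau>))"
    by (simp add: act_sum word_act_add sum_distrib_left mult.assoc)
  also have "\<dots> = act \<Lambda> a (act \<Lambda> b f) \<tau>"
    unfolding act_def[of \<Lambda> a] by (simp add: act_def[of \<Lambda> b, abs_def] word_act_sum)
  finally show "act \<Lambda> (a * b) f \<tau> = act \<Lambda> a (act \<Lambda> b f) \<tau>" .
qed

lemma act_free_gen [simp]: "act \<Lambda> (free_gen x) f = gen_act \<Lambda> x f"
  by (simp add: fun_eq_iff free_gen_def word_act_def)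

lemma act_const_mult: "act \<Lambda> (Poly_Mapping.single 0 c * a) f \<tau> = c * act \<Lambda> a f \<tau>"
  by (simp add: act_mult)

section \<open>Functions vanishing in large degrees\<close>

lemma negligible_zero [simp]: "negligible \<Lambda> (\<lambda>_. 0)"
  by (simp add: negligible_def)

lemma negligible_add:
  fixes \<Lambda> :: "('v, 'm, 'k::finite) kgraph"
  assumes "negligible \<Lambda> f" "negligible \<Lambda> g"
  shows "negligible \<Lambda> (\<lambda>\<tau>. f \<tau> + g \<tau>)"
proof -
  from assms obtain N M where
    *: "\<forall>\<tau>\<in>Mor \<Lambda>. N \<le> deg \<Lambda> \<tau> \<longrightarrow> f \<tau> = 0" "\<forall>\<tau>\<in>Mor \<Lambda>. M \<le> deg \<Lambda> \<tau> \<longrightarrow> g \<tau> = 0"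
    by (auto simp: negligible_def)
  \<comment> \<open>Degrees are only partially ordered; the sum serves as a common upper bound of
    the two thresholds.\<close>
  have "f \<tau> + g \<tau> = 0" if "\<tau> \<in> Mor \<Lambda>" "N + M \<le> deg \<Lambda> \<tau>" for \<tau>
    using * that vec_le_add[of N M] vec_le_add[of M N] order.trans
    by (metis add.right_neutral)
  then show ?thesis unfolding negligible_def by blast
qed

lemma negligible_cmult: "negligible \<Lambda> f \<Longrightarrow> negligible \<Lambda> (\<lambda>\<tau>. c * f \<tau>)"
  by (auto simp: negligible_def)

lemma negligible_sum:
  "(\<And>i. i \<in> A \<Longrightarrow> negligible \<Lambda> (g i)) \<Longrightarrow> negligible \<Lambda> (\<lambda>\<tau>. \<Sum>i\<in>A. g i \<tau>)"
  by (induction A rule: infinite_finite_induct) (auto simp: negligible_add)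

text \<open>The kernel of the action on the quotient by negligible functions. The proof uses only
  that it contains the ideal of relations, not that the two agree.\<close>

definition annihilator ::
  "('v, 'm, 'k::finite) kgraph \<Rightarrow> (('v, 'm) kp_gen free_word \<Rightarrow>\<^sub>0 'f::field) set" where
  "annihilator \<Lambda> = {a \<in> carrier (free_algebra (kp_gens \<Lambda>)). \<forall>f. negligible \<Lambda> (act \<Lambda> a f)}"

section \<open>The Kumjian-Pask relations on functions modulo negligible ones\<close>

context k_graph
begin

lemma gen_act_s_comp [simp]:
  assumes "\<kappa> \<in> Mor \<Lambda>" "\<rho> \<in> Mor \<Lambda>" "src \<Lambda> \<kappa> = rng \<Lambda> \<rho>"
  shows "gen_act \<Lambda> (Gen_s \<kappa>) f (cmp \<Lambda> \<kappa> \<rho>) = f \<rho>"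
proof -
  have "(THE \<rho>'. extends \<Lambda> \<kappa> \<rho>' (cmp \<Lambda> \<kappa> \<rho>)) = \<rho>"
    using assms comp_unique by (intro the_equality) (auto simp: extends_def)
  then show ?thesis using assms by (auto simp: extends_def)
qed

text \<open>Trades the definite description in \<open>gen_act\<close> for a case distinction with an
  explicit tail \<open>\<rho>\<close>.\<close>

lemma gen_act_s_cases:
  obtains \<rho> where "extends \<Lambda> \<kappa> \<rho> \<tau>" "gen_act \<Lambda> (Gen_s \<kappa>) f \<tau> = f \<rho>"
  | "\<And>\<rho>. \<not> extends \<Lambda> \<kappa> \<rho> \<tau>" "gen_act \<Lambda> (Gen_s \<kappa>) f \<tau> = 0"
proof (cases "\<exists>\<rho>. extends \<Lambda> \<kappa> \<rho> \<tau>")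
  case True
  then obtain \<rho> where \<rho>: "extends \<Lambda> \<kappa> \<rho> \<tau>" by auto
  then have "gen_act \<Lambda> (Gen_s \<kappa>) f \<tau> = f \<rho>"
    using gen_act_s_comp by (auto simp: extends_def simp del: gen_act.simps)
  with \<rho> that(1) show thesis by blast
next
  case False
  with that(2) show thesis by auto
qed

lemma negligible_gen_act:
  assumes "negligible \<Lambda> f"
  shows "negligible \<Lambda> (gen_act \<Lambda> x f)"
proof -
  from assms obtain N where N: "\<And>\<tau>. \<tau> \<in> Mor \<Lambda> \<Longrightarrow> N \<le> deg \<Lambda> \<tau> \<Longrightarrow> f \<tau> = 0"
    by (auto simp: negligible_def)
  show ?thesis
  proof (cases x)
    case (Gen_p v)
    with N show ?thesis by (auto simp: negligible_def)
  next
    case (Gen_s \<kappa>)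
    \<comment> \<open>Removing \<open>\<kappa>\<close> from the front shortens the path, so the
      threshold rises by the degree of \<open>\<kappa>\<close>. Prefixing, in the starred case
      below, lengthens it and keeps the threshold.\<close>
    have "gen_act \<Lambda> x f \<tau> = 0" if "\<tau> \<in> Mor \<Lambda>" "N + deg \<Lambda> \<kappa> \<le> deg \<Lambda> \<tau>" for \<tau>
    proof (cases rule: gen_act_s_cases[of \<kappa> \<tau> f])
      case (1 \<rho>)
      then have "N + deg \<Lambda> \<kappa> \<le> deg \<Lambda> \<rho> + deg \<Lambda> \<kappa>"
        using that by (auto simp: extends_def deg_comp add.commute)
      then have "f \<rho> = 0" using N[of \<rho>] 1(1) by (auto simp: extends_def vec_add_le_cancel)
      with 1 Gen_s show ?thesis by simp
    next
      case 2
      with Gen_s show ?thesis by simp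
    qed
    then show ?thesis unfolding negligible_def by blast
  next
    case (Gen_s_star \<kappa>)
    have "f (cmp \<Lambda> \<kappa> \<tau>) = 0" if "\<tau> \<in> Mor \<Lambda>" "N \<le> deg \<Lambda> \<tau>" "\<kappa> \<in> Mor \<Lambda>" "src \<Lambda> \<kappa> = rng \<Lambda> \<tau>" for \<tau>
      using that by (intro N) (auto simp: comp_closed deg_comp intro: order.trans[OF _ vec_le_add(2)])
    with Gen_s_star show ?thesis unfolding negligible_def by auto
  qed
qed

lemma negligible_word_act:
  assumes "negligible \<Lambda> f"
  shows "negligible \<Lambda> (word_act \<Lambda> w f)"
proof (cases w)
  case (Word xs)
  then show ?thesis using assms
    by (induction xs arbitrary: w) (auto simp: word_act_def intro!: negligible_gen_act)
qed

lemma negligible_act: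
  assumes "negligible \<Lambda> f"
  shows "negligible \<Lambda> (act \<Lambda> a f)"
  unfolding act_def[abs_def]
  by (intro negligible_sum negligible_cmult negligible_word_act assms)

text \<open>A path of degree at least \<open>n\<close> has exactly one initial segment of degree
  \<open>n\<close>, and only the summand of that segment survives. A path without such a segment
  kills the whole sum but not \<open>fp v\<close>, so \<open>n\<close> is a genuine
  threshold.\<close>

lemma negligible_KP4:
  assumes "row_finite_no_sources \<Lambda>" "v \<in> Obj \<Lambda>"
  shows "negligible \<Lambda> (act \<Lambda> (fp v - (\<Sum>\<kappa>\<in>paths_at \<Lambda> v n. fs \<kappa> * fs_star \<kappa>)) f)"
proof -
  have "(\<Sum>\<kappa>\<in>paths_at \<Lambda> v n. gen_act \<Lambda> (Gen_s \<kappa>) (gen_act \<Lambda> (Gen_s_star \<kappa>) f) \<tau>)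
      = gen_act \<Lambda> (Gen_p v) f \<tau>" if \<tau>: "\<tau> \<in> Mor \<Lambda>" "n \<le> deg \<Lambda> \<tau>" for \<tau>
  proof -
    obtain \<kappa> \<rho> where \<kappa>: "\<kappa> \<in> Mor \<Lambda>" "\<rho> \<in> Mor \<Lambda>" "src \<Lambda> \<kappa> = rng \<Lambda> \<rho>" "deg \<Lambda> \<kappa> = n" "\<tau> = cmp \<Lambda> \<kappa> \<rho>"
      using factor[OF \<tau>] by metis
    have "gen_act \<Lambda> (Gen_s \<nu>) (gen_act \<Lambda> (Gen_s_star \<nu>) f) \<tau> = (if \<nu> = \<kappa> then f \<tau> else 0)"
      if \<nu>: "\<nu> \<in> paths_at \<Lambda> v n" for \<nu>
    proof (cases rule: gen_act_s_cases[of \<nu> \<tau> "gen_act \<Lambda> (Gen_s_star \<nu>) f"])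
      case (1 \<sigma>)
      then have "\<nu> = \<kappa> \<and> \<sigma> = \<rho>"
        using comp_unique[of \<nu> \<sigma> \<kappa> \<rho>] \<kappa> \<nu> by (auto simp: extends_def paths_at_def paths_def)
      with 1 \<kappa> show ?thesis by simp
    next
      case 2
      with \<kappa> have "\<nu> \<noteq> \<kappa>" by (auto simp: extends_def)
      with 2 show ?thesis by simp
    qed
    then have "(\<Sum>\<nu>\<in>paths_at \<Lambda> v n. gen_act \<Lambda> (Gen_s \<nu>) (gen_act \<Lambda> (Gen_s_star \<nu>) f) \<tau>)
        = (\<Sum>\<nu>\<in>paths_at \<Lambda> v n. if \<nu> = \<kappa> then f \<tau> else 0)"
      by (intro sum.cong) auto
    also have "\<dots> = (if \<kappa> \<in> paths_at \<Lambda> v n then f \<tau> else 0)"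
      using assms by (simp add: row_finite_no_sources_def)
    also have "\<dots> = gen_act \<Lambda> (Gen_p v) f \<tau>"
      using \<kappa> by (auto simp: paths_at_def paths_def rng_comp)
    finally show ?thesis .
  qed
  then show ?thesis
    unfolding negligible_def
    by (intro exI[of _ n]) (auto simp: act_diff act_sum act_mult simp del: gen_act.simps)
qed

lemma negligibleI: "(\<And>\<tau>. \<tau> \<in> Mor \<Lambda> \<Longrightarrow> f \<tau> = 0) \<Longrightarrow> negligible \<Lambda> f"
  by (auto simp: negligible_def)

text \<open>Every relation except (KP4) holds exactly at all paths, by unique factorization or by
  associativity and the range and source laws.\<close>

lemma negligible_relation:
  assumes "row_finite_no_sources \<Lambda>" "a \<in> kp_relations \<Lambda>"
  shows "negligible \<Lambda> (act \<Lambda> a f)"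
  using assms(2)
proof cases
  case (KP1 u v)
  then show ?thesis by (intro negligibleI) (auto simp: act_diff act_mult)
next
  case (KP2_comp \<kappa> \<mu>)
  then have m: "\<kappa> \<in> Mor \<Lambda>" "\<mu> \<in> Mor \<Lambda>" by auto
  have "gen_act \<Lambda> (Gen_s \<kappa>) (gen_act \<Lambda> (Gen_s \<mu>) f) \<tau> = gen_act \<Lambda> (Gen_s (cmp \<Lambda> \<kappa> \<mu>)) f \<tau>" for \<tau>
  \<comment> \<open>Stripping the composite succeeds exactly when stripping \<open>\<kappa>\<close>
    and then \<open>\<mu>\<close> does, and the remaining tail is the same.\<close>
  proof (cases rule: gen_act_s_cases[of "cmp \<Lambda> \<kappa> \<mu>" \<tau> f])
    case (1 \<sigma>)
    then have \<sigma>: "\<sigma> \<in> Mor \<Lambda>" "src \<Lambda> \<mu> = rng \<Lambda> \<sigma>" "\<tau> = cmp \<Lambda> \<kappa> (cmp \<Lambda> \<mu> \<sigma>)"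
      using m KP2_comp(4) by (auto simp: extends_def src_comp comp_assoc)
    then show ?thesis
      using 1 m KP2_comp(4) by (simp add: comp_closed rng_comp del: gen_act.simps)
  next
    case no: 2
    show ?thesis
    proof (cases rule: gen_act_s_cases[of \<kappa> \<tau> "gen_act \<Lambda> (Gen_s \<mu>) f"])
      case \<rho>: (1 \<rho>)
      show ?thesis
      proof (cases rule: gen_act_s_cases[of \<mu> \<rho> f])
        case (1 \<sigma>)
        then have "extends \<Lambda> (cmp \<Lambda> \<kappa> \<mu>) \<sigma> \<tau>"
          using \<rho>(1) m KP2_comp(4) by (auto simp: extends_def src_comp comp_assoc comp_closed)
        with no show ?thesis by blast
      next
        case 2
        with \<rho> no show ?thesis by simp
      qed
    next
      case 2
      with no show ?thesis by simp
    qed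
  qed
  with KP2_comp(1) show ?thesis
    by (intro negligibleI) (simp add: act_diff act_mult del: gen_act.simps)
next
  case (KP2_comp_star \<kappa> \<mu>)
  then have m: "\<kappa> \<in> Mor \<Lambda>" "\<mu> \<in> Mor \<Lambda>" by auto
  then show ?thesis
    using KP2_comp_star
    by (intro negligibleI) (auto simp: act_diff act_mult rng_comp src_comp comp_assoc comp_closed)
next
  case (KP2_rng \<kappa>)
  have "gen_act \<Lambda> (Gen_p (rng \<Lambda> \<kappa>)) (gen_act \<Lambda> (Gen_s \<kappa>) f) \<tau> = gen_act \<Lambda> (Gen_s \<kappa>) f \<tau>" for \<tau>
    by (cases rule: gen_act_s_cases[of \<kappa> \<tau> f])
      (auto simp: extends_def rng_comp simp del: gen_act.simps(2))
  with KP2_rng show ?thesis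
    by (intro negligibleI) (simp add: act_diff act_mult del: gen_act.simps)
next
  case (KP2_src \<kappa>)
  have "gen_act \<Lambda> (Gen_s \<kappa>) (gen_act \<Lambda> (Gen_p (src \<Lambda> \<kappa>)) f) \<tau> = gen_act \<Lambda> (Gen_s \<kappa>) f \<tau>" for \<tau>
  proof (cases "\<exists>\<rho>. extends \<Lambda> \<kappa> \<rho> \<tau>")
    case True
    then show ?thesis by (auto simp: extends_def simp del: gen_act.simps(2))
  qed simp
  with KP2_src show ?thesis
    by (intro negligibleI) (simp add: act_diff act_mult del: gen_act.simps)
next
  case (KP2_src_star \<kappa>)
  then show ?thesis by (intro negligibleI) (auto simp: act_diff act_mult)
next
  case (KP2_rng_star \<kappa>)
  then show ?thesis by (intro negligibleI) (auto simp: act_diff act_mult rng_comp)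
next
  case (KP3 \<kappa> \<mu>)
  then have m: "\<kappa> \<in> Mor \<Lambda>" "\<mu> \<in> Mor \<Lambda>" by auto
  have "gen_act \<Lambda> (Gen_s_star \<kappa>) (gen_act \<Lambda> (Gen_s \<mu>) f) \<tau>
      = (if \<kappa> = \<mu> then gen_act \<Lambda> (Gen_p (src \<Lambda> \<kappa>)) f \<tau> else 0)" if "\<tau> \<in> Mor \<Lambda>" for \<tau>
  proof (cases "src \<Lambda> \<kappa> = rng \<Lambda> \<tau>")
    case True
    show ?thesis
    proof (cases rule: gen_act_s_cases[of \<mu> "cmp \<Lambda> \<kappa> \<tau>" f])
      case (1 \<sigma>)
      then have "\<kappa> = \<mu> \<and> \<tau> = \<sigma>"
        using comp_unique[of \<kappa> \<tau> \<mu> \<sigma>] m True that KP3 by (auto simp: extends_def)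
      with 1 m True show ?thesis by (simp del: gen_act.simps(2))
    next
      case 2
      then have "\<kappa> \<noteq> \<mu>" using m True that by (auto simp: extends_def)
      with 2 show ?thesis by (simp del: gen_act.simps(2))
    qed
  next
    case False
    then show ?thesis by (auto simp del: gen_act.simps(2))
  qed
  with KP3(1) show ?thesis
    by (intro negligibleI) (simp add: act_diff act_mult del: gen_act.simps)
next
  case (KP4 v n)
  then show ?thesis using negligible_KP4[OF assms(1)] by simp
qed

end


section \<open>Computing in presented algebras\<close>

lemma carrier_free_algebra:
  "a \<in> carrier (free_algebra gs) \<longleftrightarrow> (\<forall>w\<in>Poly_Mapping.keys a. set (letters w) \<subseteq> gs)"
  by (simp add: free_algebra_def)

lemma free_algebra_simps [simp]:
  "monoid.mult (free_algebra gs) = (*)" "monoid.one (free_algebra gs) = 1"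
  "ring.zero (free_algebra gs) = 0" "ring.add (free_algebra gs) = (+)"
  by (auto simp: free_algebra_def ring_of_type_algebra_def)

lemma single_zero_in_free_algebra: "Poly_Mapping.single 0 c \<in> carrier (free_algebra gs)"
  by (auto simp: carrier_free_algebra zero_free_word_def)

lemma free_gen_in_free_algebra: "x \<in> gs \<Longrightarrow> free_gen x \<in> carrier (free_algebra gs)"
  by (auto simp: carrier_free_algebra free_gen_def)

lemma zero_in_free_algebra: "0 \<in> carrier (free_algebra gs)"
  by (simp add: carrier_free_algebra)

lemma add_in_free_algebra:
  "a \<in> carrier (free_algebra gs) \<Longrightarrow> b \<in> carrier (free_algebra gs) \<Longrightarrow>
    a + b \<in> carrier (free_algebra gs)"
  using keys_add[of a b] unfolding carrier_free_algebra by blast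

lemma mult_in_free_algebra:
  assumes "a \<in> carrier (free_algebra gs)" "b \<in> carrier (free_algebra gs)"
  shows "a * b \<in> carrier (free_algebra gs)"
  using assms keys_mult[of a b] unfolding carrier_free_algebra
  by (fastforce simp: plus_free_word_def)

lemma uminus_in_free_algebra:
  "a \<in> carrier (free_algebra gs) \<Longrightarrow> - a \<in> carrier (free_algebra gs)"
  by (auto simp: carrier_free_algebra in_keys_iff)

lemma diff_in_free_algebra:
  "a \<in> carrier (free_algebra gs) \<Longrightarrow> b \<in> carrier (free_algebra gs) \<Longrightarrow>
    a - b \<in> carrier (free_algebra gs)"
  using add_in_free_algebra[of a gs "- b"] uminus_in_free_algebra[of b gs] by simp

lemma sum_in_free_algebra:
  "(\<And>i. i \<in> A \<Longrightarrow> g i \<in> carrier (free_algebra gs)) \<Longrightarrow> sum g A \<in> carrier (free_algebra gs)"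
  by (induction A rule: infinite_finite_induct) (auto simp: zero_in_free_algebra add_in_free_algebra)

lemmas in_free_algebra = single_zero_in_free_algebra free_gen_in_free_algebra zero_in_free_algebra
  add_in_free_algebra mult_in_free_algebra uminus_in_free_algebra diff_in_free_algebra
  sum_in_free_algebra

lemma one_in_free_algebra: "1 \<in> carrier (free_algebra gs)"
  by (metis single_zero_in_free_algebra single_one)

lemma ring_free_algebra: "ring (free_algebra gs)"
proof (intro ringI abelian_groupI monoidI)
  fix a :: "'a free_word \<Rightarrow>\<^sub>0 'b"
  assume "a \<in> carrier (free_algebra gs)"
  then show "\<exists>b\<in>carrier (free_algebra gs). b \<oplus>\<^bsub>free_algebra gs\<^esub> a = \<zero>\<^bsub>free_algebra gs\<^esub>"
    by (intro bexI[of _ "- a"]) (auto simp: in_free_algebra)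
qed (auto simp: in_free_algebra one_in_free_algebra algebra_simps)

locale presentation =
  fixes gs :: "'g set" and Rel :: "('g free_word \<Rightarrow>\<^sub>0 'f::field) set"
    and e :: "'g free_word \<Rightarrow>\<^sub>0 'f"
  assumes Rel_carrier: "Rel \<subseteq> carrier (free_algebra gs)"
begin

abbreviation "R \<equiv> free_algebra gs :: ('g free_word \<Rightarrow>\<^sub>0 'f) ring"
abbreviation "I \<equiv> Idl\<^bsub>R\<^esub> Rel"
abbreviation "A \<equiv> presented_algebra gs Rel e"
abbreviation "cls \<equiv> presented_class gs Rel"

text \<open>The augmentation ideal, that is, the free non-unital algebra inside the unital
  one.\<close>

definition aug :: "('g free_word \<Rightarrow>\<^sub>0 'f) set" where
  "aug = {a \<in> carrier R. Poly_Mapping.lookup a 0 = 0}"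

sublocale I: ideal I R
  using ring.genideal_ideal[OF ring_free_algebra Rel_carrier] .

lemma cls_add: "a \<in> carrier R \<Longrightarrow> b \<in> carrier R \<Longrightarrow> cls a \<oplus>\<^bsub>A\<^esub> cls b = cls (a + b)"
  using I.a_rcos_sum[of a b] by (simp add: presented_algebra_def presented_class_def)

lemma cls_mult: "a \<in> carrier R \<Longrightarrow> b \<in> carrier R \<Longrightarrow> cls a \<otimes>\<^bsub>A\<^esub> cls b = cls (a * b)"
  using I.rcoset_mult_add[of a b] by (simp add: presented_algebra_def presented_class_def)

lemma cls_eqD:
  assumes "a \<in> carrier R" "cls a = cls b"
  shows "a - b \<in> I"
proof -
  have "a \<in> cls b"
    using I.a_rcos_self[of a] assms by (simp add: presented_class_def)
  then show ?thesis
    by (auto simp: presented_class_def a_r_coset_def')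
qed

text \<open>Scalar multiplication is defined as a union over all representatives of a coset; since
  the ideal absorbs constants, they all contribute the same coset.\<close>

lemma cls_smult:
  assumes "a \<in> carrier R"
  shows "c \<odot>\<^bsub>A\<^esub> cls a = cls (Poly_Mapping.single 0 c * a)"
proof -
  have "cls (Poly_Mapping.single 0 c * b) = cls (Poly_Mapping.single 0 c * a)" if "b \<in> cls a" for b
  proof -
    from that obtain i where i: "i \<in> I" "b = i + a"
      by (auto simp: presented_class_def a_r_coset_def')
    have "Poly_Mapping.single 0 c * i \<in> I"
      using I.I_l_closed[OF i(1) single_zero_in_free_algebra] by simp
    then have "Poly_Mapping.single 0 c * b \<in> cls (Poly_Mapping.single 0 c * a)"
      by (auto simp: presented_class_def a_r_coset_def' i(2) distrib_left)
    then show ?thesis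
      unfolding presented_class_def
      using I.a_repr_independence'[of "Poly_Mapping.single 0 c * b" "Poly_Mapping.single 0 c * a"] assms
      by (simp add: in_free_algebra)
  qed
  moreover have "a \<in> cls a"
    using I.a_rcos_self[OF assms] by (simp add: presented_class_def)
  ultimately have "(\<Union>b\<in>cls a. cls (Poly_Mapping.single 0 c * b)) = cls (Poly_Mapping.single 0 c * a)"
    by blast
  then show ?thesis by (simp add: presented_algebra_def)
qed

lemma carrier_presented_algebra: "carrier A = cls ` aug"
  by (simp add: presented_algebra_def aug_def)

text \<open>Makes the laws of finite sums available, so that the \<open>finsum\<close> in
  \<open>lin_span\<close> can be reindexed and unfolded.\<close>

lemma comm_monoid_presented_algebra: "comm_monoid (add_monoid A)"
proof (rule comm_monoidI)
  have *: "x \<in> carrier (add_monoid A) \<longleftrightarrow> (\<exists>a. a \<in> carrier R \<and> Poly_Mapping.lookup a 0 = 0 \<and> x = cls a)" for x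
    by (auto simp: carrier_presented_algebra aug_def)
  have z: "\<one>\<^bsub>add_monoid A\<^esub> = cls 0" by (simp add: presented_algebra_def)
  have m: "monoid.mult (add_monoid A) = ring.add A" by simp
  show "\<one>\<^bsub>add_monoid A\<^esub> \<in> carrier (add_monoid A)"
    unfolding * z by (intro exI[of _ 0]) (auto simp: in_free_algebra)
  fix x y z
  assume "x \<in> carrier (add_monoid A)" "y \<in> carrier (add_monoid A)"
  then obtain a b where ab: "a \<in> carrier R" "Poly_Mapping.lookup a 0 = 0" "x = cls a"
     "b \<in> carrier R" "Poly_Mapping.lookup b 0 = 0" "y = cls b"
    unfolding * by auto
  then show "x \<otimes>\<^bsub>add_monoid A\<^esub> y \<in> carrier (add_monoid A)"
    unfolding * m by (intro exI[of _ "a + b"]) (simp add: cls_add in_free_algebra lookup_add)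
  show "x \<otimes>\<^bsub>add_monoid A\<^esub> y = y \<otimes>\<^bsub>add_monoid A\<^esub> x"
    unfolding m using ab by (simp add: cls_add add.commute)
  show "\<one>\<^bsub>add_monoid A\<^esub> \<otimes>\<^bsub>add_monoid A\<^esub> x = x"
    unfolding m z using ab by (simp add: cls_add in_free_algebra)
  assume "z \<in> carrier (add_monoid A)"
  then obtain c where "c \<in> carrier R" "z = cls c" unfolding * by auto
  with ab show "x \<otimes>\<^bsub>add_monoid A\<^esub> y \<otimes>\<^bsub>add_monoid A\<^esub> z = x \<otimes>\<^bsub>add_monoid A\<^esub> (y \<otimes>\<^bsub>add_monoid A\<^esub> z)"
    unfolding m by (simp add: cls_add in_free_algebra add.assoc)
qed

lemma const_mult_aug:
  assumes "a \<in> aug"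
  shows "Poly_Mapping.single 0 c * a \<in> aug"
proof -
  have "Poly_Mapping.lookup (Poly_Mapping.single 0 c * a) 0 = 0"
    using assms by (simp add: aug_def map.rep_eq when_def flip: mult_map_scale_conv_mult)
  then show ?thesis using assms by (auto simp: aug_def in_free_algebra)
qed

text \<open>Lifts a linear combination of cosets to a single polynomial on which \<open>act\<close>
  can be evaluated.\<close>

lemma lin_span_cls:
  assumes S: "S \<subseteq> cls ` B" "B \<subseteq> aug" and x: "x \<in> lin_span A S"
  obtains c T where "finite T" "T \<subseteq> B" "x = cls (\<Sum>a\<in>T. Poly_Mapping.single 0 (c a) * a)"
proof -
  interpret am: comm_monoid "add_monoid A" by (rule comm_monoid_presented_algebra)
  from x obtain c T' where T': "finite T'" "T' \<subseteq> S" and x: "x = finsum A (\<lambda>x. c x \<odot>\<^bsub>A\<^esub> x) T'"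
    by (auto simp: lin_span_def)
  then have "T' \<subseteq> cls ` B" using S by auto
  \<comment> \<open>One representative per coset: the span sums over a set of cosets, so two
    representatives of one coset would count it twice.\<close>
  then obtain T where T: "T \<subseteq> B" "inj_on cls T" "T' = cls ` T"
    using subset_image_inj by metis
  have fT: "finite T" using T'(1) T finite_image_iff by metis
  have aug: "T \<subseteq> aug" using T S by auto
  have "x = finsum A (\<lambda>a. c (cls a) \<odot>\<^bsub>A\<^esub> cls a) T"
  proof -
    have "c x \<odot>\<^bsub>A\<^esub> x \<in> carrier A" if "x \<in> cls ` T" for x
      using that aug cls_smult const_mult_aug by (auto simp: carrier_presented_algebra aug_def)
    then show ?thesis
      unfolding x T(3) finsum_def using T(2)
      by (subst am.finprod_reindex) auto
  qed
  also have "\<dots> = cls (\<Sum>a\<in>T. Poly_Mapping.single 0 (c (cls a)) * a)"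
    using fT aug
  proof (induction T rule: finite_induct)
    case empty
    show ?case unfolding finsum_def am.finprod_empty by (simp add: presented_algebra_def)
  next
    case (insert a T)
    have car: "c (cls b) \<odot>\<^bsub>A\<^esub> cls b \<in> carrier A" "Poly_Mapping.single 0 (c (cls b)) * b \<in> carrier R"
      if "b \<in> aug" for b
      using that const_mult_aug cls_smult[of b] by (auto simp: carrier_presented_algebra aug_def)
    have "finsum A (\<lambda>a. c (cls a) \<odot>\<^bsub>A\<^esub> cls a) (Set.insert a T)
        = (c (cls a) \<odot>\<^bsub>A\<^esub> cls a) \<oplus>\<^bsub>A\<^esub> finsum A (\<lambda>a. c (cls a) \<odot>\<^bsub>A\<^esub> cls a) T"
      unfolding finsum_def using insert car by (subst am.finprod_insert) auto
    also have "\<dots> = cls (Poly_Mapping.single 0 (c (cls a)) * a + (\<Sum>a\<in>T. Poly_Mapping.single 0 (c (cls a)) * a))"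
      using insert car by (subst insert.IH) (auto simp: cls_smult aug_def intro!: cls_add sum_in_free_algebra)
    finally show ?case using insert by simp
  qed
  finally show thesis by (rule that[OF fT T(1)])
qed

end

section \<open>The ideal of relations inside the annihilator\<close>

context k_graph
begin

text \<open>Closure under right factors comes from quantifying over all functions, closure under
  left factors from \<open>negligible_act\<close>.\<close>

lemma ideal_annihilator:
  "ideal (annihilator \<Lambda> :: (('v, 'm) kp_gen free_word \<Rightarrow>\<^sub>0 'f::field) set) (free_algebra (kp_gens \<Lambda>))"
proof (rule idealI[OF ring_free_algebra])
  let ?R = "free_algebra (kp_gens \<Lambda>) :: (('v, 'm) kp_gen free_word \<Rightarrow>\<^sub>0 'f) ring"
  interpret R: ring ?R by (rule ring_free_algebra)
  show "subgroup (annihilator \<Lambda>) (add_monoid ?R)"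
  proof (rule group.subgroupI[OF R.a_group])
    show "annihilator \<Lambda> \<noteq> {}"
      by (auto simp: annihilator_def act_def[abs_def] in_free_algebra intro!: exI[of _ 0])
    fix a b :: "('v, 'm) kp_gen free_word \<Rightarrow>\<^sub>0 'f"
    assume a: "a \<in> annihilator \<Lambda>"
    have na: "- a \<in> annihilator \<Lambda>"
      using a by (auto simp: annihilator_def in_free_algebra act_uminus[abs_def] negligible_def)
    have "inv\<^bsub>add_monoid ?R\<^esub> a = - a"
      using R.minus_equality[of "- a" a] a na by (simp add: annihilator_def a_inv_def)
    with na show "inv\<^bsub>add_monoid ?R\<^esub> a \<in> annihilator \<Lambda>" by simp
    assume b: "b \<in> annihilator \<Lambda>"
    show "a \<otimes>\<^bsub>add_monoid ?R\<^esub> b \<in> annihilator \<Lambda>"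
      using a b by (auto simp: annihilator_def in_free_algebra act_add[abs_def] negligible_add)
  qed (auto simp: annihilator_def)
  fix a x :: "('v, 'm) kp_gen free_word \<Rightarrow>\<^sub>0 'f"
  assume "a \<in> annihilator \<Lambda>" "x \<in> carrier ?R"
  then have *: "a * x \<in> carrier ?R" "x * a \<in> carrier ?R" "negligible \<Lambda> (act \<Lambda> a f)" for f
    by (auto simp: annihilator_def mult_in_free_algebra)
  then show "x \<otimes>\<^bsub>?R\<^esub> a \<in> annihilator \<Lambda>" "a \<otimes>\<^bsub>?R\<^esub> x \<in> annihilator \<Lambda>"
    using negligible_act[OF *(3)] by (simp_all add: annihilator_def act_mult)
qed

lemma kp_relations_carrier:
  assumes "row_finite_no_sources \<Lambda>"
  shows "kp_relations \<Lambda> \<subseteq> carrier (free_algebra (kp_gens \<Lambda>))"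
proof
  have s: "fs \<kappa> \<in> carrier (free_algebra (kp_gens \<Lambda>))" "fs_star \<kappa> \<in> carrier (free_algebra (kp_gens \<Lambda>))"
    if "\<kappa> \<in> Mor \<Lambda>" "deg \<Lambda> \<kappa> \<noteq> 0" for \<kappa>
    using that by (auto intro!: free_gen_in_free_algebra simp: kp_gens_def paths_def)
  have p: "fp v \<in> carrier (free_algebra (kp_gens \<Lambda>))" if "v \<in> Obj \<Lambda>" for v
    using that by (auto intro!: free_gen_in_free_algebra simp: kp_gens_def)
  \<comment> \<open>Only paths of nonzero degree index generators of type \<open>s\<close>, so the
    composites in (KP2) have to be checked.\<close>
  have c: "deg \<Lambda> (cmp \<Lambda> \<kappa> \<mu>) \<noteq> 0"
    if "\<kappa> \<in> Mor \<Lambda>" "\<mu> \<in> Mor \<Lambda>" "src \<Lambda> \<kappa> = rng \<Lambda> \<mu>" "deg \<Lambda> \<kappa> \<noteq> 0" for \<kappa> \<mu>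
    using that by (auto simp: deg_comp vec_eq_iff)
  fix a :: "('v, 'm) kp_gen free_word \<Rightarrow>\<^sub>0 'f::field"
  assume "a \<in> kp_relations \<Lambda>"
  then show "a \<in> carrier (free_algebra (kp_gens \<Lambda>))"
    by cases (auto intro!: mult_in_free_algebra diff_in_free_algebra sum_in_free_algebra s p
      simp: c rng_closed src_closed comp_closed paths_at_def paths_def zero_in_free_algebra)
qed

end


section \<open>Crossed products\<close>

text \<open>A representative of the coset \<open>kp_s\<close> in the free algebra, where the action
  is defined.\<close>

definition s_rep ::
  "('v, 'm, 'k::finite) kgraph \<Rightarrow> 'm \<Rightarrow> (('v, 'm) kp_gen free_word \<Rightarrow>\<^sub>0 'f::field)" where
  "s_rep \<Lambda> \<kappa> = (if \<kappa> \<in> paths \<Lambda> 0 then fp (rng \<Lambda> \<kappa>) else fs \<kappa>)"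

definition s_star_rep ::
  "('v, 'm, 'k::finite) kgraph \<Rightarrow> 'm \<Rightarrow> (('v, 'm) kp_gen free_word \<Rightarrow>\<^sub>0 'f::field)" where
  "s_star_rep \<Lambda> \<kappa> = (if \<kappa> \<in> paths \<Lambda> 0 then fp (rng \<Lambda> \<kappa>) else fs_star \<kappa>)"

context k_graph
begin

text \<open>A path of degree 0 is an identity, and stripping it changes nothing; vertices thus
  follow the formula for \<open>Gen_s\<close> and need no separate treatment later.\<close>

lemma act_s_rep:
  assumes "\<tau> \<in> Mor \<Lambda>"
  shows "act \<Lambda> (s_rep \<Lambda> \<kappa>) f \<tau> = gen_act \<Lambda> (Gen_s \<kappa>) f \<tau>"
proof (cases "\<kappa> \<in> paths \<Lambda> 0")
  case True
  then have \<kappa>: "\<kappa> \<in> Mor \<Lambda>" "src \<Lambda> \<kappa> = rng \<Lambda> \<kappa>" "\<kappa> = ident \<Lambda> (rng \<Lambda> \<kappa>)"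
    using deg_zero_ident by (auto simp: paths_def)
  have "gen_act \<Lambda> (Gen_s \<kappa>) f \<tau> = (if rng \<Lambda> \<tau> = rng \<Lambda> \<kappa> then f \<tau> else 0)"
  proof (cases "rng \<Lambda> \<tau> = rng \<Lambda> \<kappa>")
    case eq: True
    then have "cmp \<Lambda> \<kappa> \<tau> = \<tau>" using ident_comp[OF assms] \<kappa>(3) by simp
    then show ?thesis
      using gen_act_s_comp[of \<kappa> \<tau> f] \<kappa> assms eq by simp
  next
    case False
    then have "\<not> extends \<Lambda> \<kappa> \<rho> \<tau>" for \<rho> using rng_comp by (auto simp: extends_def)
    with False show ?thesis by simp
  qed
  with True show ?thesis by (simp add: s_rep_def)
next
  case False
  then show ?thesis by (simp add: s_rep_def del: gen_act.simps)
qed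

lemma act_s_star_rep:
  assumes "\<tau> \<in> Mor \<Lambda>" "\<kappa> \<in> Mor \<Lambda>"
  shows "act \<Lambda> (s_star_rep \<Lambda> \<kappa>) f \<tau> = gen_act \<Lambda> (Gen_s_star \<kappa>) f \<tau>"
proof (cases "\<kappa> \<in> paths \<Lambda> 0")
  case True
  then have \<kappa>: "src \<Lambda> \<kappa> = rng \<Lambda> \<kappa>" "\<kappa> = ident \<Lambda> (rng \<Lambda> \<kappa>)"
    using deg_zero_ident by (auto simp: paths_def)
  have "cmp \<Lambda> \<kappa> \<tau> = \<tau>" if "rng \<Lambda> \<tau> = rng \<Lambda> \<kappa>"
    using ident_comp[OF assms(1)] \<kappa>(2) that by simp
  with True \<kappa>(1) assms show ?thesis by (auto simp: s_star_rep_def)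
next
  case False
  then show ?thesis by (simp add: s_star_rep_def del: gen_act.simps)
qed

text \<open>
  On paths extending a long path \<open>\<nu>\<close>, a homogeneous element acts by substituting initial
  segments, so that it becomes a matrix with rows indexed by the paths \<open>\<nu>\<close> of degree \<open>m + n\<close>
  and columns indexed by the paths of degree \<open>m\<close>.
\<close>

definition matrix_form ::
  "nat^'k \<Rightarrow> nat^'k \<Rightarrow> (('m \<Rightarrow> 'f::field) \<Rightarrow> 'm \<Rightarrow> 'f) \<Rightarrow> ('m \<Rightarrow> 'm \<Rightarrow> 'f) \<Rightarrow> bool" where
  "matrix_form m n F \<phi> \<longleftrightarrow> (\<forall>\<nu>\<in>paths \<Lambda> (m + n). \<forall>f. \<forall>\<tau>\<in>Mor \<Lambda>. src \<Lambda> \<nu> = rng \<Lambda> \<tau> \<longrightarrow>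
     F f (cmp \<Lambda> \<nu> \<tau>) = (\<Sum>\<mu> | \<mu> \<in> paths \<Lambda> m \<and> src \<Lambda> \<mu> = src \<Lambda> \<nu>. \<phi> \<nu> \<mu> * f (cmp \<Lambda> \<mu> \<tau>)))"

text \<open>Since \<open>deg \<Lambda> \<kappa>' \<le> m\<close>, the degree of
  \<open>\<kappa>\<close> is at most that of the row index \<open>\<nu>\<close>. Whether
  \<open>\<kappa>\<close> can be stripped is then decided by \<open>\<nu>\<close> alone, whatever
  tail \<open>\<tau>\<close> follows.\<close>

lemma matrix_form_monomial:
  assumes fin: "finite (paths \<Lambda> m)"
    and \<kappa>: "\<kappa> \<in> Mor \<Lambda>" "\<kappa>' \<in> Mor \<Lambda>" "deg \<Lambda> \<kappa> = deg \<Lambda> \<kappa>' + n" "deg \<Lambda> \<kappa>' \<le> m"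
  shows "\<exists>\<phi>. matrix_form m n (act \<Lambda> (s_rep \<Lambda> \<kappa> * s_star_rep \<Lambda> \<kappa>' :: _ \<Rightarrow>\<^sub>0 'f::field)) \<phi>"
proof -
  \<comment> \<open>The entry is 1 exactly when replacing the prefix \<open>\<kappa>\<close> of
    \<open>\<nu>\<close> by \<open>\<kappa>'\<close> gives \<open>\<mu>\<close>.\<close>
  define \<phi> :: "'m \<Rightarrow> 'm \<Rightarrow> 'f" where "\<phi> \<nu> \<mu> =
    (if \<exists>\<rho>. extends \<Lambda> \<kappa> \<rho> \<nu> \<and> extends \<Lambda> \<kappa>' \<rho> \<mu> then 1 else 0)" for \<nu> \<mu>
  have "act \<Lambda> (s_rep \<Lambda> \<kappa> * s_star_rep \<Lambda> \<kappa>') f (cmp \<Lambda> \<nu> \<tau>)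
      = (\<Sum>\<mu> | \<mu> \<in> paths \<Lambda> m \<and> src \<Lambda> \<mu> = src \<Lambda> \<nu>. \<phi> \<nu> \<mu> * f (cmp \<Lambda> \<mu> \<tau>))" (is "?L = ?R")
    if "\<nu> \<in> paths \<Lambda> (m + n)" and \<tau>: "\<tau> \<in> Mor \<Lambda>" "src \<Lambda> \<nu> = rng \<Lambda> \<tau>" for \<nu> f \<tau>
  proof -
    have \<nu>: "\<nu> \<in> Mor \<Lambda>" "deg \<Lambda> \<nu> = m + n" using that by (auto simp: paths_def)
    let ?S = "gen_act \<Lambda> (Gen_s \<kappa>) (act \<Lambda> (s_star_rep \<Lambda> \<kappa>') f)"
    have L: "?L = ?S (cmp \<Lambda> \<nu> \<tau>)"
      using \<nu> \<tau> by (simp add: act_mult act_s_rep comp_closed del: gen_act.simps)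
    have "deg \<Lambda> \<kappa> \<le> deg \<Lambda> \<nu>"
      using \<kappa> \<nu> by (simp add: vec_add_le_cancel)
    then obtain \<alpha> \<rho> where \<alpha>: "\<alpha> \<in> Mor \<Lambda>" "\<rho> \<in> Mor \<Lambda>" "src \<Lambda> \<alpha> = rng \<Lambda> \<rho>" "deg \<Lambda> \<alpha> = deg \<Lambda> \<kappa>"
        "\<nu> = cmp \<Lambda> \<alpha> \<rho>"
      using factor[OF \<nu>(1)] by metis
    have \<rho>\<tau>: "src \<Lambda> \<rho> = rng \<Lambda> \<tau>" "src \<Lambda> \<nu> = src \<Lambda> \<rho>"
      using \<alpha> \<tau> src_comp by auto
    have eq: "cmp \<Lambda> \<nu> \<tau> = cmp \<Lambda> \<alpha> (cmp \<Lambda> \<rho> \<tau>)" "cmp \<Lambda> \<rho> \<tau> \<in> Mor \<Lambda>" "rng \<Lambda> (cmp \<Lambda> \<rho> \<tau>) = rng \<Lambda> \<rho>"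
      using \<alpha> \<rho>\<tau> \<tau> by (auto simp: comp_assoc comp_closed rng_comp)
    have unique: "\<kappa> = \<alpha> \<and> \<rho>' = \<rho>" if "extends \<Lambda> \<kappa> \<rho>' \<nu>" for \<rho>'
      using that comp_unique[of \<kappa> \<rho>' \<alpha> \<rho>] \<alpha> by (auto simp: extends_def)
    show ?thesis
    \<comment> \<open>Either the replacement is possible and row \<open>\<nu>\<close> has a single
      entry 1, or row and action both vanish, because \<open>\<kappa>\<close> is no prefix or
      because \<open>\<kappa>'\<close> does not compose with the tail.\<close>
    proof (cases "\<kappa> = \<alpha> \<and> src \<Lambda> \<kappa>' = rng \<Lambda> \<rho>")
      case True
      have \<phi>: "\<phi> \<nu> \<mu> = (if \<mu> = cmp \<Lambda> \<kappa>' \<rho> then 1 else 0)" for \<mu>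
      proof -
        have "(\<exists>\<rho>'. extends \<Lambda> \<kappa> \<rho>' \<nu> \<and> extends \<Lambda> \<kappa>' \<rho>' \<mu>) \<longleftrightarrow> \<mu> = cmp \<Lambda> \<kappa>' \<rho>"
        proof
          assume "\<exists>\<rho>'. extends \<Lambda> \<kappa> \<rho>' \<nu> \<and> extends \<Lambda> \<kappa>' \<rho>' \<mu>"
          with unique have "extends \<Lambda> \<kappa>' \<rho> \<mu>" by blast
          then show "\<mu> = cmp \<Lambda> \<kappa>' \<rho>" by (simp add: extends_def)
        next
          assume "\<mu> = cmp \<Lambda> \<kappa>' \<rho>"
          then have "extends \<Lambda> \<kappa> \<rho> \<nu> \<and> extends \<Lambda> \<kappa>' \<rho> \<mu>"
            using True \<alpha> \<kappa>(2) by (simp add: extends_def)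
          then show "\<exists>\<rho>'. extends \<Lambda> \<kappa> \<rho>' \<nu> \<and> extends \<Lambda> \<kappa>' \<rho>' \<mu>" by blast
        qed
        then show ?thesis by (simp add: \<phi>_def)
      qed
      have mem: "cmp \<Lambda> \<kappa>' \<rho> \<in> paths \<Lambda> m \<and> src \<Lambda> (cmp \<Lambda> \<kappa>' \<rho>) = src \<Lambda> \<nu>"
      proof -
        have "deg \<Lambda> \<kappa>' + n + deg \<Lambda> \<rho> = m + n"
          using \<alpha> \<nu>(2) \<kappa>(3) by (auto simp: deg_comp)
        then have "(deg \<Lambda> \<kappa>' + deg \<Lambda> \<rho>) + n = m + n"
          by (simp add: ac_simps)
        then have "deg \<Lambda> \<kappa>' + deg \<Lambda> \<rho> = m" by simp
        then show ?thesis
          using True \<kappa>(2) \<alpha>(2) \<rho>\<tau> by (simp add: paths_def comp_closed deg_comp src_comp)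
      qed
      have "?R = (\<Sum>\<mu> | \<mu> \<in> paths \<Lambda> m \<and> src \<Lambda> \<mu> = src \<Lambda> \<nu>.
          if \<mu> = cmp \<Lambda> \<kappa>' \<rho> then f (cmp \<Lambda> (cmp \<Lambda> \<kappa>' \<rho>) \<tau>) else 0)"
        by (intro sum.cong) (auto simp: \<phi>)
      also have "\<dots> = f (cmp \<Lambda> (cmp \<Lambda> \<kappa>' \<rho>) \<tau>)"
        using fin mem by simp
      also have "\<dots> = f (cmp \<Lambda> \<kappa>' (cmp \<Lambda> \<rho> \<tau>))"
        using True \<kappa>(2) \<alpha>(2) \<rho>\<tau> \<tau> by (simp add: comp_assoc)
      also have "\<dots> = act \<Lambda> (s_star_rep \<Lambda> \<kappa>') f (cmp \<Lambda> \<rho> \<tau>)"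
        using eq(2,3) True \<kappa>(2) by (simp add: act_s_star_rep)
      also have "\<dots> = ?L"
        unfolding L unfolding eq(1) using True \<alpha>(1-3) eq(2,3) by (simp del: gen_act.simps)
      finally show ?thesis ..
    next
      case False
      have "\<not> (extends \<Lambda> \<kappa> \<rho>' \<nu> \<and> extends \<Lambda> \<kappa>' \<rho>' \<mu>)" for \<rho>' \<mu>
      proof
        assume *: "extends \<Lambda> \<kappa> \<rho>' \<nu> \<and> extends \<Lambda> \<kappa>' \<rho>' \<mu>"
        with unique have "\<kappa> = \<alpha>" "\<rho>' = \<rho>" by blast+
        moreover from * have "src \<Lambda> \<kappa>' = rng \<Lambda> \<rho>'" by (simp add: extends_def)
        ultimately show False using False by blast
      qed
      then have "\<phi> \<nu> \<mu> = 0" for \<mu> unfolding \<phi>_def by meson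
      then have "?R = 0" by simp
      also have "0 = ?L"
      proof (cases "\<kappa> = \<alpha>")
        case True
        then have "?L = act \<Lambda> (s_star_rep \<Lambda> \<kappa>') f (cmp \<Lambda> \<rho> \<tau>)"
          unfolding L unfolding eq(1) using \<alpha>(1-3) eq(2,3) by (simp del: gen_act.simps)
        also have "\<dots> = 0"
          using False True eq(2,3) \<kappa>(2) by (simp add: act_s_star_rep)
        finally show ?thesis ..
      next
        case ne: False
        have "\<not> extends \<Lambda> \<kappa> \<sigma> (cmp \<Lambda> \<nu> \<tau>)" for \<sigma>
        proof
          assume "extends \<Lambda> \<kappa> \<sigma> (cmp \<Lambda> \<nu> \<tau>)"
          then have "\<kappa> = \<alpha>"
            using comp_unique[of \<kappa> \<sigma> \<alpha> "cmp \<Lambda> \<rho> \<tau>"] eq \<alpha> by (simp add: extends_def)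
          with ne show False by simp
        qed
        then show ?thesis unfolding L by simp
      qed
      finally show ?thesis ..
    qed
  qed
  then show ?thesis by (intro exI[of _ \<phi>]) (simp add: matrix_form_def)
qed

lemma matrix_form_sum:
  assumes "\<And>i. i \<in> T \<Longrightarrow> \<exists>\<phi>. matrix_form m n (act \<Lambda> (g i)) \<phi>"
  shows "\<exists>\<phi>. matrix_form m n (act \<Lambda> (\<Sum>i\<in>T. Poly_Mapping.single 0 (c i) * g i)) \<phi>"
proof -
  from assms obtain \<phi> where \<phi>: "\<And>i. i \<in> T \<Longrightarrow> matrix_form m n (act \<Lambda> (g i)) (\<phi> i)" by metis
  have "matrix_form m n (act \<Lambda> (\<Sum>i\<in>T. Poly_Mapping.single 0 (c i) * g i))
      (\<lambda>\<nu> \<mu>. \<Sum>i\<in>T. c i * \<phi> i \<nu> \<mu>)"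
    unfolding matrix_form_def
  proof (intro ballI allI impI)
    fix \<nu> f \<tau>
    assume *: "\<nu> \<in> paths \<Lambda> (m + n)" "\<tau> \<in> Mor \<Lambda>" "src \<Lambda> \<nu> = rng \<Lambda> \<tau>"
    let ?Q = "{\<mu>. \<mu> \<in> paths \<Lambda> m \<and> src \<Lambda> \<mu> = src \<Lambda> \<nu>}"
    have "act \<Lambda> (\<Sum>i\<in>T. Poly_Mapping.single 0 (c i) * g i) f (cmp \<Lambda> \<nu> \<tau>)
        = (\<Sum>i\<in>T. c i * (\<Sum>\<mu>\<in>?Q. \<phi> i \<nu> \<mu> * f (cmp \<Lambda> \<mu> \<tau>)))"
      unfolding act_sum act_const_mult
      using \<phi> * by (intro sum.cong) (auto simp: matrix_form_def)
    also have "\<dots> = (\<Sum>\<mu>\<in>?Q. (\<Sum>i\<in>T. c i * \<phi> i \<nu> \<mu>) * f (cmp \<Lambda> \<mu> \<tau>))"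
      unfolding sum_distrib_left sum_distrib_right
      by (subst sum.swap) (simp add: mult.assoc)
    finally show "act \<Lambda> (\<Sum>i\<in>T. Poly_Mapping.single 0 (c i) * g i) f (cmp \<Lambda> \<nu> \<tau>)
        = (\<Sum>\<mu>\<in>?Q. (\<Sum>i\<in>T. c i * \<phi> i \<nu> \<mu>) * f (cmp \<Lambda> \<mu> \<tau>))" .
  qed
  then show ?thesis by blast
qed

text \<open>
  With more rows than columns there is a nonzero row vector annihilating the matrix, which
  contradicts right invertibility on the indicator function of the extensions of a path.
\<close>

lemma matrix_form_not_right_invertible:
  assumes rf: "row_finite_no_sources \<Lambda>"
    and fin: "finite (paths \<Lambda> m)" "finite (paths \<Lambda> (m + n))"
    and card: "card (paths \<Lambda> m) < card (paths \<Lambda> (m + n))"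
    and F: "matrix_form m n F \<phi>"
    and G: "\<And>f. negligible \<Lambda> (\<lambda>\<tau>. F (G f) \<tau> - f \<tau>)"
  shows False
proof -
  obtain z \<nu>0 where z: "\<nu>0 \<in> paths \<Lambda> (m + n)" "z \<nu>0 \<noteq> 0"
    "\<And>\<mu>. \<mu> \<in> paths \<Lambda> m \<Longrightarrow>
      (\<Sum>\<nu>\<in>paths \<Lambda> (m + n). z \<nu> * (if src \<Lambda> \<mu> = src \<Lambda> \<nu> then \<phi> \<nu> \<mu> else 0)) = 0"
    \<comment> \<open>Filling the entries between different sources with 0 gives one matrix on all
      paths, so the comparison of the total counts applies.\<close>
    using exists_left_kernel[OF fin card, of "\<lambda>\<nu> \<mu>. if src \<Lambda> \<mu> = src \<Lambda> \<nu> then \<phi> \<nu> \<mu> else 0"]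
    by blast
  define w where "w = src \<Lambda> \<nu>0"
  let ?P = "{\<nu> \<in> paths \<Lambda> (m + n). src \<Lambda> \<nu> = w}" and ?Q = "{\<mu> \<in> paths \<Lambda> m. src \<Lambda> \<mu> = w}"
  \<comment> \<open>Restricting \<open>z\<close> to the block of \<open>w\<close> keeps it in the
    kernel, and it stays nonzero there because \<open>\<nu>0\<close> belongs to the block.\<close>
  have zw: "(\<Sum>\<nu>\<in>?P. z \<nu> * \<phi> \<nu> \<mu>) = 0" if "\<mu> \<in> ?Q" for \<mu>
  proof -
    have "(\<Sum>\<nu>\<in>?P. z \<nu> * \<phi> \<nu> \<mu>)
        = (\<Sum>\<nu>\<in>paths \<Lambda> (m + n). z \<nu> * (if src \<Lambda> \<mu> = src \<Lambda> \<nu> then \<phi> \<nu> \<mu> else 0))"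
      using that fin by (intro sum.mono_neutral_cong_left) auto
    also have "\<dots> = 0" using z(3) that by blast
    finally show ?thesis .
  qed
  define g where "g \<sigma> = (if \<exists>\<tau>. extends \<Lambda> \<nu>0 \<tau> \<sigma> then 1 else 0 :: 'a)" for \<sigma>
  from G[of g] obtain N where N: "\<And>\<tau>. \<tau> \<in> Mor \<Lambda> \<Longrightarrow> N \<le> deg \<Lambda> \<tau> \<Longrightarrow> F (G g) \<tau> = g \<tau>"
    by (auto simp: negligible_def)
  have "w \<in> Obj \<Lambda>" using z(1) by (auto simp: w_def paths_def src_closed)
  \<comment> \<open>One tail composes with every row and column index of the block and puts every
    extended row beyond the threshold \<open>N\<close>.\<close>
  then obtain \<tau> where \<tau>: "\<tau> \<in> Mor \<Lambda>" "rng \<Lambda> \<tau> = w" "deg \<Lambda> \<tau> = N"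
    using path_exists[OF rf] by metis
  have "z \<nu> * F (G g) (cmp \<Lambda> \<nu> \<tau>) = (if \<nu> = \<nu>0 then z \<nu>0 else 0)" if \<nu>: "\<nu> \<in> ?P" for \<nu>
  proof -
    have "F (G g) (cmp \<Lambda> \<nu> \<tau>) = g (cmp \<Lambda> \<nu> \<tau>)"
      using \<nu> \<tau> by (intro N) (auto simp: paths_def comp_closed deg_comp vec_le_add)
    moreover have "(\<exists>\<sigma>. extends \<Lambda> \<nu>0 \<sigma> (cmp \<Lambda> \<nu> \<tau>)) \<longleftrightarrow> \<nu> = \<nu>0"
    proof
      assume "\<exists>\<sigma>. extends \<Lambda> \<nu>0 \<sigma> (cmp \<Lambda> \<nu> \<tau>)"
      then obtain \<sigma> where "extends \<Lambda> \<nu>0 \<sigma> (cmp \<Lambda> \<nu> \<tau>)" ..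
      then show "\<nu> = \<nu>0"
        using comp_unique[of \<nu>0 \<sigma> \<nu> \<tau>] \<nu> z(1) \<tau> by (auto simp: extends_def paths_def)
    next
      assume "\<nu> = \<nu>0"
      then show "\<exists>\<sigma>. extends \<Lambda> \<nu>0 \<sigma> (cmp \<Lambda> \<nu> \<tau>)"
        using \<nu> \<tau> by (auto simp: extends_def paths_def)
    qed
    ultimately show ?thesis by (simp add: g_def)
  qed
  then have "(\<Sum>\<nu>\<in>?P. z \<nu> * F (G g) (cmp \<Lambda> \<nu> \<tau>)) = (\<Sum>\<nu>\<in>?P. if \<nu> = \<nu>0 then z \<nu>0 else 0)"
    by (intro sum.cong) auto
  also have "\<dots> = z \<nu>0"
    using z(1) fin by (simp add: w_def)
  finally have 1: "(\<Sum>\<nu>\<in>?P. z \<nu> * F (G g) (cmp \<Lambda> \<nu> \<tau>)) = z \<nu>0" .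
  have "(\<Sum>\<nu>\<in>?P. z \<nu> * F (G g) (cmp \<Lambda> \<nu> \<tau>))
      = (\<Sum>\<nu>\<in>?P. z \<nu> * (\<Sum>\<mu>\<in>?Q. \<phi> \<nu> \<mu> * G g (cmp \<Lambda> \<mu> \<tau>)))"
    using F \<tau> by (intro sum.cong) (auto simp: matrix_form_def)
  also have "\<dots> = (\<Sum>\<mu>\<in>?Q. (\<Sum>\<nu>\<in>?P. z \<nu> * \<phi> \<nu> \<mu>) * G g (cmp \<Lambda> \<mu> \<tau>))"
    unfolding sum_distrib_left sum_distrib_right
    by (subst sum.swap) (simp add: mult.assoc)
  also have "\<dots> = 0" using zw by simp
  finally show False using 1 z(2) by simp
qed

text \<open>Translates the unit from cosets to polynomials: the identity \<open>a * b = e\<close>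
  holds modulo the ideal of relations, hence modulo negligible functions.\<close>

lemma KP_component_right_invertible:
  assumes rf: "row_finite_no_sources \<Lambda>" and fin: "finite (paths \<Lambda> 0)"
    and x: "x \<in> KP_component TYPE('f::field) \<Lambda> (int_vec n)" "x \<in> Units (KP TYPE('f) \<Lambda>)"
  obtains T c b where "finite T"
    "T \<subseteq> {(\<kappa>, \<mu>). \<kappa> \<in> Mor \<Lambda> \<and> \<mu> \<in> Mor \<Lambda> \<and> deg \<Lambda> \<kappa> = deg \<Lambda> \<mu> + n}"
    "\<And>f :: 'm \<Rightarrow> 'f. negligible \<Lambda> (\<lambda>\<tau>. act \<Lambda> (\<Sum>p\<in>T. Poly_Mapping.single 0 (c p) *
        (s_rep \<Lambda> (fst p) * s_star_rep \<Lambda> (snd p))) (act \<Lambda> b f) \<tau> - f \<tau>)"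
proof -
  let ?gs = "kp_gens \<Lambda>"
  let ?Rel = "kp_relations \<Lambda> :: (('v, 'm) kp_gen free_word \<Rightarrow>\<^sub>0 'f) set"
  let ?e = "\<Sum>v\<in>Obj \<Lambda>. fp v :: ('v, 'm) kp_gen free_word \<Rightarrow>\<^sub>0 'f"
  interpret P: presentation ?gs ?Rel ?e
    using kp_relations_carrier[OF rf] by unfold_locales
  have KP: "KP TYPE('f) \<Lambda> = P.A" by (simp add: KP_def)
  have s: "kp_s TYPE('f) \<Lambda> \<kappa> = P.cls (s_rep \<Lambda> \<kappa>)" "kp_s_star TYPE('f) \<Lambda> \<kappa> = P.cls (s_star_rep \<Lambda> \<kappa>)" for \<kappa>
    by (simp_all add: kp_s_def kp_s_star_def s_rep_def s_star_rep_def)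
  have car: "s_rep \<Lambda> \<kappa> \<in> carrier P.R" "s_star_rep \<Lambda> \<kappa> \<in> carrier P.R" if "\<kappa> \<in> Mor \<Lambda>" for \<kappa>
    using that unfolding s_rep_def s_star_rep_def
    by (auto intro!: free_gen_in_free_algebra simp: kp_gens_def rng_closed)
  let ?I = "{(\<kappa>, \<mu>). \<kappa> \<in> Mor \<Lambda> \<and> \<mu> \<in> Mor \<Lambda> \<and> deg \<Lambda> \<kappa> = deg \<Lambda> \<mu> + n}"
  let ?m = "\<lambda>p. s_rep \<Lambda> (fst p) * s_star_rep \<Lambda> (snd p) :: ('v, 'm) kp_gen free_word \<Rightarrow>\<^sub>0 'f"
  have aug: "?m ` ?I \<subseteq> P.aug"
  proof -
    \<comment> \<open>Each \<open>?m p\<close> is a single word of length two, so it has no constant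
      term.\<close>
    have "Poly_Mapping.lookup (?m p) 0 = 0" for p
      by (auto simp: s_rep_def s_star_rep_def free_gen_def mult_single lookup_single when_def
          plus_free_word_def zero_free_word_def)
    then show ?thesis by (auto simp: P.aug_def mult_in_free_algebra car)
  qed
  have sub: "{kp_s TYPE('f) \<Lambda> \<kappa> \<otimes>\<^bsub>P.A\<^esub> kp_s_star TYPE('f) \<Lambda> \<mu> | \<kappa> \<mu>.
        \<kappa> \<in> Mor \<Lambda> \<and> \<mu> \<in> Mor \<Lambda> \<and> int_vec (deg \<Lambda> \<kappa>) - int_vec (deg \<Lambda> \<mu>) = int_vec n} \<subseteq> P.cls ` ?m ` ?I"
  proof clarify
    fix \<kappa> \<mu>
    assume *: "\<kappa> \<in> Mor \<Lambda>" "\<mu> \<in> Mor \<Lambda>" "int_vec (deg \<Lambda> \<kappa>) - int_vec (deg \<Lambda> \<mu>) = int_vec n"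
    then have "(\<kappa>, \<mu>) \<in> ?I" by (simp add: int_vec_diff_eq_iff)
    moreover have "kp_s TYPE('f) \<Lambda> \<kappa> \<otimes>\<^bsub>P.A\<^esub> kp_s_star TYPE('f) \<Lambda> \<mu> = P.cls (?m (\<kappa>, \<mu>))"
      using * car by (simp add: s P.cls_mult)
    ultimately show "kp_s TYPE('f) \<Lambda> \<kappa> \<otimes>\<^bsub>P.A\<^esub> kp_s_star TYPE('f) \<Lambda> \<mu> \<in> P.cls ` ?m ` ?I"
      by blast
  qed
  have "x \<in> lin_span P.A {kp_s TYPE('f) \<Lambda> \<kappa> \<otimes>\<^bsub>P.A\<^esub> kp_s_star TYPE('f) \<Lambda> \<mu> | \<kappa> \<mu>.
        \<kappa> \<in> Mor \<Lambda> \<and> \<mu> \<in> Mor \<Lambda> \<and> int_vec (deg \<Lambda> \<kappa>) - int_vec (deg \<Lambda> \<mu>) = int_vec n}"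
    using x(1) by (simp only: KP_component_def KP)
  then obtain c T' where T': "finite T'" "T' \<subseteq> ?m ` ?I"
    "x = P.cls (\<Sum>a\<in>T'. Poly_Mapping.single 0 (c a) * a)"
    by (rule P.lin_span_cls[OF sub aug]) (rule that)
  \<comment> \<open>Choosing one pair per monomial provides the injectivity that
    \<open>sum.reindex\<close> requires.\<close>
  from T'(2) obtain T where T: "T \<subseteq> ?I" "inj_on ?m T" "T' = ?m ` T"
    unfolding subset_image_inj by blast
  have fT: "finite T" using finite_imageD[of ?m T] T'(1) T(2,3) by simp
  define a where "a = (\<Sum>p\<in>T. Poly_Mapping.single 0 (c (?m p)) * ?m p)"
  have xa: "x = P.cls a"
    unfolding T'(3) a_def T(3) using T(2) by (simp add: sum.reindex)
  have ac: "a \<in> carrier P.R"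
    using T(1) car unfolding a_def by (auto intro!: sum_in_free_algebra mult_in_free_algebra single_zero_in_free_algebra)
  from x(2) obtain y where y: "y \<in> carrier P.A" "x \<otimes>\<^bsub>P.A\<^esub> y = \<one>\<^bsub>P.A\<^esub>"
    unfolding KP by (auto simp: Units_def)
  then obtain b where b: "b \<in> carrier P.R" "y = P.cls b"
    by (auto simp: P.carrier_presented_algebra P.aug_def)
  have "P.cls (a * b) = P.cls ?e"
    using y(2) unfolding xa b(2) P.cls_mult[OF ac b(1)] by (simp add: presented_algebra_def)
  then have "a * b - ?e \<in> P.I"
    using P.cls_eqD ac b(1) mult_in_free_algebra by blast
  also have "P.I \<subseteq> annihilator \<Lambda>"
  proof (rule ring.genideal_minimal[OF ring_free_algebra ideal_annihilator])
    show "?Rel \<subseteq> annihilator \<Lambda>"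
      using negligible_relation[OF rf] kp_relations_carrier[OF rf] by (auto simp: annihilator_def)
  qed
  finally have ann: "negligible \<Lambda> (act \<Lambda> (a * b - ?e) f)" for f
    by (simp add: annihilator_def)
  \<comment> \<open>Every path has exactly one range vertex, so the finite sum of the vertex
    idempotents acts as the identity.\<close>
  have "act \<Lambda> (a * b - ?e) f \<tau> = act \<Lambda> a (act \<Lambda> b f) \<tau> - f \<tau>" if "\<tau> \<in> Mor \<Lambda>" for f \<tau>
    using finite_Obj[OF fin] that by (simp add: act_diff act_sum act_mult rng_closed)
  with ann have "negligible \<Lambda> (\<lambda>\<tau>. act \<Lambda> a (act \<Lambda> b f) \<tau> - f \<tau>)" for f
    unfolding negligible_def by metis
  then show thesis using that[OF fT T(1), of "\<lambda>p. c (?m p)" b] unfolding a_def by blast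
qed

end

theorem corollary5p2p5:
  fixes \<Lambda> :: "('v, 'm, 'k::finite) kgraph"
  assumes "k_graph \<Lambda>"
    and "row_finite_no_sources \<Lambda>"
    and "finite (paths \<Lambda> 0)"
    and "crossed_product (KP TYPE('f::field) \<Lambda>) (KP_component TYPE('f) \<Lambda>)"
  shows "HNE \<Lambda>"
proof (rule ccontr)
  interpret k_graph \<Lambda> by fact
  note rf = assms(2) and fin = assms(3)
  assume "\<not> HNE \<Lambda>"
  then obtain \<mu> \<kappa> where \<mu>: "loop \<Lambda> \<mu>" "entrance \<Lambda> \<mu> \<kappa>" by (auto simp: HNE_def)
  let ?n = "deg \<Lambda> \<mu>"
  obtain x where x: "x \<in> KP_component TYPE('f) \<Lambda> (int_vec ?n)" "x \<in> Units (KP TYPE('f) \<Lambda>)"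
    using assms(4) by (auto simp: crossed_product_def)
  obtain T c b where T: "finite T"
    "T \<subseteq> {(\<kappa>, \<mu>). \<kappa> \<in> Mor \<Lambda> \<and> \<mu> \<in> Mor \<Lambda> \<and> deg \<Lambda> \<kappa> = deg \<Lambda> \<mu> + ?n}"
    "\<And>f :: 'm \<Rightarrow> 'f. negligible \<Lambda> (\<lambda>\<tau>. act \<Lambda> (\<Sum>p\<in>T. Poly_Mapping.single 0 (c p) *
        (s_rep \<Lambda> (fst p) * s_star_rep \<Lambda> (snd p))) (act \<Lambda> b f) \<tau> - f \<tau>)"
    by (rule KP_component_right_invertible[OF rf fin x]) (rule that)
  \<comment> \<open>The sum is a convenient common upper bound for the degrees of all starred paths
    in the unit.\<close>
  obtain m where m: "(\<Sum>p\<in>T. deg \<Lambda> (snd p)) \<le> m" "card (paths \<Lambda> m) < card (paths \<Lambda> (m + ?n))"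
    using loop_entrance_card_less[OF rf fin \<mu>] .
  have le: "deg \<Lambda> (snd p) \<le> m" if "p \<in> T" for p
    using sum.remove[OF T(1) that, of "\<lambda>p. deg \<Lambda> (snd p)"] m(1) vec_le_add(1) order.trans by metis
  have "\<exists>\<phi>. matrix_form m ?n (act \<Lambda> (s_rep \<Lambda> (fst p) * s_star_rep \<Lambda> (snd p) :: _ \<Rightarrow>\<^sub>0 'f)) \<phi>"
    if "p \<in> T" for p
  proof (rule matrix_form_monomial[OF finite_paths[OF fin rf]])
    have "p \<in> {(\<kappa>, \<mu>). \<kappa> \<in> Mor \<Lambda> \<and> \<mu> \<in> Mor \<Lambda> \<and> deg \<Lambda> \<kappa> = deg \<Lambda> \<mu> + ?n}"
      using that T(2) by blast
    then show "fst p \<in> Mor \<Lambda>" "snd p \<in> Mor \<Lambda>" "deg \<Lambda> (fst p) = deg \<Lambda> (snd p) + ?n"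
      by (simp_all add: split_beta)
  qed (rule le[OF that])
  from matrix_form_sum[of T m ?n "\<lambda>p. s_rep \<Lambda> (fst p) * s_star_rep \<Lambda> (snd p)", OF this] obtain \<phi> where
    "matrix_form m ?n (act \<Lambda> (\<Sum>p\<in>T. Poly_Mapping.single 0 (c p) *
        (s_rep \<Lambda> (fst p) * s_star_rep \<Lambda> (snd p)))) \<phi>"
    by blast
  from matrix_form_not_right_invertible[OF rf finite_paths[OF fin rf] finite_paths[OF fin rf] m(2) this T(3)]
  show False .
qed

end
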